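(* Consider the problem $$F(x)=f(x)+g(x)=f(x)+\frac1m\sum_{k=1}^m g_k(x)\to\min_{x\in\mathbb{R}^n},$$ where $f,g_1,\dots,g_m:\mathbb{R}^n\to\mathbb{R}$ are convex and differentiable, $\nabla f$ is $L_f$-Lipschitz and each $\nabla g_k$ is $L_g$-Lipschitz with respect to the Euclidean norm $\|\cdot\|_2$, and $F$ is $\mu$-strongly convex with respect to $\|\cdot\|_2$, where $\mu>0$, $\mu\ll L_f$ and $m\le L_g/\mu$. Assume in addition that $mL_f\le L_g$. Then there is a (randomized) first-order algorithm which, for every such problem, every starting point and every target accuracy $\varepsilon>0$, solves the problem to accuracy $\varepsilon$ using $$\tilde{\mathrm O}\left(\sqrt{\frac{L_f}{\mu}}\right)\ \text{ computations of }\ \nabla f \qquad\text{and}\qquad \tilde{\mathrm O}\left(\sqrt{\frac{mL_g}{\mu}}\right)\ \text{ computations of gradients }\ \nabla g_k .$$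
   Context: Oracle model: the algorithm is given $n,m,L_f,L_g,\mu,\varepsilon$ and a starting point $x^0\in\mathbb{R}^n$, and accesses the functions only through gradient oracles. One computation of $\nabla f$ means evaluating $\nabla f(x)$ at one point $x$. One computation of $\nabla g_k$ means evaluating the gradient $\nabla g_k(x)$ of a single summand, for one index $k\in\{1,\dots,m\}$ chosen by the algorithm and one point $x$. Thus one evaluation of the full gradient $\nabla g$ costs $m$ computations of $\nabla g_k$, and the count in the claim is the total over all indices $k$. The functions $f$ and $g_k$ are not assumed to be proximally friendly. Arithmetic operations not involving oracle calls are not counted. Solving to accuracy $\varepsilon$ means producing a (random) point $\hat x$ with $\mathbb{E}\,F(\hat x)-\min_{x\in\mathbb{R}^n}F(x)\le\varepsilon$. The notation $\tilde{\mathrm O}(\cdot)$ means $\mathrm O(\cdot)$ up to logarithmic factors: the bound holds with an absolute constant times a factor polylogarithmic in $L_f/\mu$, $L_g/\mu$, $m$ and $(F(x^0)-\min F)/\varepsilon$. In particular the accuracy $\varepsilon$ enters only through logarithmic factors. The notation $\mu\ll L_f$ means that $L_f/\mu\ge c_0$ for a sufficiently large absolute constant $c_0\geq 1$. *)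

theory Defs
  imports "HOL-Analysis.Analysis" "HOL-Probability.Probability_Mass_Function"
begin

section \<open>Euclidean spaces of varying dimension\<close>

text \<open>
  The constants of the complexity bound must not depend on the dimension \<open>n\<close>, so \<open>n\<close> has to be
  quantified inside the formula and cannot be a type. All spaces \<open>\<real>\<^sup>n\<close> are therefore
  realised inside one inner product space, the finitely supported real sequences: \<open>Rn n\<close> is the
  subspace of the sequences vanishing from index \<open>n\<close> on, with the usual dot product
  (lemma \<open>inner_Rn\<close>). Functions on \<open>\<real>\<^sup>n\<close> are total functions on sequences of which only
  the restriction to \<open>Rn n\<close> matters.
\<close>

typedef fseq = "{x :: nat \<Rightarrow> real. finite {i. x i \<noteq> 0}}"
  morphisms coord Abs_fseq
  by (rule exI[of _ "\<lambda>_. 0"]) simp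

setup_lifting type_definition_fseq

lemma finite_coord [simp]: "finite {i. coord x i \<noteq> 0}"
  using coord[of x] by simp

lemma fseq_eqI: "(\<And>i. coord x i = coord y i) \<Longrightarrow> x = y"
  by (simp add: coord_inject[symmetric] ext)

instantiation fseq :: real_vector
begin

lift_definition zero_fseq :: fseq is "\<lambda>_. 0"
  by simp

lift_definition plus_fseq :: "fseq \<Rightarrow> fseq \<Rightarrow> fseq" is "\<lambda>x y i. x i + y i"
proof -
  fix x y :: "nat \<Rightarrow> real"
  assume "finite {i. x i \<noteq> 0}" "finite {i. y i \<noteq> 0}"
  then show "finite {i. x i + y i \<noteq> 0}"
    by (rule finite_subset[rotated, OF finite_UnI]) auto
qed

lift_definition uminus_fseq :: "fseq \<Rightarrow> fseq" is "\<lambda>x i. - x i"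
  by simp

lift_definition minus_fseq :: "fseq \<Rightarrow> fseq \<Rightarrow> fseq" is "\<lambda>x y i. x i - y i"
proof -
  fix x y :: "nat \<Rightarrow> real"
  assume "finite {i. x i \<noteq> 0}" "finite {i. y i \<noteq> 0}"
  then show "finite {i. x i - y i \<noteq> 0}"
    by (rule finite_subset[rotated, OF finite_UnI]) auto
qed

lift_definition scaleR_fseq :: "real \<Rightarrow> fseq \<Rightarrow> fseq" is "\<lambda>r x i. r * x i"
  by (auto elim: rev_finite_subset)

instance
  by standard (transfer; simp add: algebra_simps)+

end

lemma coord_simps [simp]:
  "coord 0 i = 0"
  "coord (x + y) i = coord x i + coord y i"
  "coord (- x) i = - coord x i"
  "coord (x - y) i = coord x i - coord y i"
  "coord (r *\<^sub>R x) i = r * coord x i"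
  by (transfer; simp)+

instantiation fseq :: real_inner
begin

definition inner_fseq :: "fseq \<Rightarrow> fseq \<Rightarrow> real" where
  "inner_fseq x y = (\<Sum>i | coord x i \<noteq> 0. coord x i * coord y i)"

definition norm_fseq :: "fseq \<Rightarrow> real" where
  "norm_fseq x = sqrt (inner x x)"

definition dist_fseq :: "fseq \<Rightarrow> fseq \<Rightarrow> real" where
  "dist_fseq x y = norm (x - y)"

definition sgn_fseq :: "fseq \<Rightarrow> fseq" where
  "sgn_fseq x = x /\<^sub>R norm x"

definition uniformity_fseq :: "(fseq \<times> fseq) filter" where
  "uniformity_fseq = (INF e\<in>{0<..}. principal {(x, y). dist x y < e})"

definition open_fseq :: "fseq set \<Rightarrow> bool" where
  "open_fseq U \<longleftrightarrow> (\<forall>x\<in>U. eventually (\<lambda>(x', y). x' = x \<longrightarrow> y \<in> U) uniformity)"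

lemma inner_fseq_superset:
  assumes "finite A" "{i. coord x i \<noteq> 0} \<subseteq> A"
  shows "inner x y = (\<Sum>i\<in>A. coord x i * coord y i)"
  unfolding inner_fseq_def using assms by (intro sum.mono_neutral_left) auto

instance
proof
  fix x y z :: fseq and r :: real
  show "dist x y = norm (x - y)" by (fact dist_fseq_def)
  show "sgn x = x /\<^sub>R norm x" by (fact sgn_fseq_def)
  show "uniformity = (INF e\<in>{0<..}. principal {(x :: fseq, y). dist x y < e})"
    by (fact uniformity_fseq_def)
  show "open U \<longleftrightarrow> (\<forall>x\<in>U. eventually (\<lambda>(x', y). x' = x \<longrightarrow> y \<in> U) uniformity)" for U :: "fseq set"
    by (fact open_fseq_def)
  show "norm x = sqrt (inner x x)" by (fact norm_fseq_def)
  define A where "A = {i. coord x i \<noteq> 0} \<union> {i. coord y i \<noteq> 0} \<union> {i. coord z i \<noteq> 0}"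
  have A: "finite A" by (simp add: A_def)
  have "inner x y = (\<Sum>i\<in>A. coord x i * coord y i)" "inner y x = (\<Sum>i\<in>A. coord y i * coord x i)"
    by (rule inner_fseq_superset[OF A]; auto simp: A_def)+
  then show "inner x y = inner y x" by (simp add: mult.commute)
  have "inner (x + y) z = (\<Sum>i\<in>A. coord (x + y) i * coord z i)"
    "inner x z = (\<Sum>i\<in>A. coord x i * coord z i)" "inner y z = (\<Sum>i\<in>A. coord y i * coord z i)"
    by (rule inner_fseq_superset[OF A]; auto simp: A_def)+
  then show "inner (x + y) z = inner x z + inner y z"
    by (simp add: algebra_simps sum.distrib)
  have "inner (r *\<^sub>R x) y = (\<Sum>i\<in>A. coord (r *\<^sub>R x) i * coord y i)"
    "inner x y = (\<Sum>i\<in>A. coord x i * coord y i)"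
    by (rule inner_fseq_superset[OF A]; auto simp: A_def)+
  then show "inner (r *\<^sub>R x) y = r * inner x y"
    by (simp add: sum_distrib_left mult.assoc)
  show "0 \<le> inner x x" unfolding inner_fseq_def by (intro sum_nonneg) simp
  show "inner x x = 0 \<longleftrightarrow> x = 0"
    unfolding inner_fseq_def
    by (subst sum_nonneg_eq_0_iff) (auto intro: fseq_eqI)
qed

end

definition Rn :: "nat \<Rightarrow> fseq set" where
  "Rn n = {x. \<forall>i\<ge>n. coord x i = 0}"

lemma subspace_Rn: "subspace (Rn n)"
  by (auto simp: subspace_def Rn_def)

lemma inner_Rn: "x \<in> Rn n \<Longrightarrow> inner x y = (\<Sum>i<n. coord x i * coord y i)"
  by (rule inner_fseq_superset) (auto simp: Rn_def not_le[symmetric])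

lemma coords_Rn: "bij_betw coord (Rn n) {v. \<forall>i\<ge>n. v i = 0}"
proof (rule bij_betw_imageI)
  show "inj_on coord (Rn n)" by (auto simp: inj_on_def coord_inject)
  show "coord ` Rn n = {v. \<forall>i\<ge>n. v i = 0}"
  proof (intro equalityI subsetI)
    fix v :: "nat \<Rightarrow> real"
    assume v: "v \<in> {v. \<forall>i\<ge>n. v i = 0}"
    then have "{i. v i \<noteq> 0} \<subseteq> {..<n}" by (auto simp: not_le[symmetric])
    then have "coord (Abs_fseq v) = v" by (simp add: Abs_fseq_inverse finite_subset)
    then show "v \<in> coord ` Rn n" using v by (intro image_eqI[of _ _ "Abs_fseq v"]) (auto simp: Rn_def)
  qed (auto simp: Rn_def)
qed

section \<open>The problem class\<close>

definition grad :: "nat \<Rightarrow> (fseq \<Rightarrow> real) \<Rightarrow> fseq \<Rightarrow> fseq" where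
  "grad n f x = (THE v. v \<in> Rn n \<and> (f has_derivative (\<lambda>h. inner v h)) (at x within Rn n))"

lemma ex1_grad:
  assumes f: "f differentiable (at x within Rn n)" and x: "x \<in> Rn n"
  shows "\<exists>!v. v \<in> Rn n \<and> (f has_derivative (\<lambda>h. inner v h)) (at x within Rn n)"
proof -
  obtain D where D: "(f has_derivative D) (at x within Rn n)"
    using f by (auto simp: differentiable_def)
  then interpret D: bounded_linear D by (rule has_derivative_bounded_linear)
  define e where "e i = Abs_fseq (\<lambda>j. if j = i then 1 else 0)" for i :: nat
  have e: "coord (e i) j = (if j = i then 1 else 0)" for i j
    by (simp add: e_def Abs_fseq_inverse)
  define v where "v = (\<Sum>i<n. D (e i) *\<^sub>R e i)"
  have coord_sum: "coord (sum h A) j = (\<Sum>i\<in>A. coord (h i) j)"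
    for h :: "nat \<Rightarrow> fseq" and A j
    by (induction A rule: infinite_finite_induct) auto
  have cv: "coord v i = (if i < n then D (e i) else 0)" for i
    by (auto simp: v_def coord_sum e if_distrib sum.delta cong: if_cong)
  have v: "v \<in> Rn n" by (simp add: Rn_def cv)
  have DR: "D h = inner v h" if h: "h \<in> Rn n" for h
  proof -
    have "h = (\<Sum>i<n. coord h i *\<^sub>R e i)"
      using h by (auto intro!: fseq_eqI simp: coord_sum e if_distrib sum.delta Rn_def cong: if_cong)
    then have "D h = D (\<Sum>i<n. coord h i *\<^sub>R e i)" by simp
    also have "\<dots> = (\<Sum>i<n. coord h i * D (e i))"
      by (simp add: D.sum D.scaleR)
    also have "\<dots> = inner v h"
      by (simp add: inner_Rn[OF v] cv mult.commute)
    finally show ?thesis .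
  qed
  have "(f has_derivative (\<lambda>h. inner v h)) (at x within Rn n)"
    unfolding has_derivative_within
  proof (intro conjI bounded_linear_inner_right)
    have "((\<lambda>y. (1 / norm (y - x)) *\<^sub>R (f y - (f x + D (y - x)))) \<longlongrightarrow> 0) (at x within Rn n)"
      using D by (simp add: has_derivative_within)
    also have "?this \<longleftrightarrow>
        ((\<lambda>y. (1 / norm (y - x)) *\<^sub>R (f y - (f x + inner v (y - x)))) \<longlongrightarrow> 0) (at x within Rn n)"
      by (rule Lim_cong_within) (auto simp: DR subspace_diff[OF subspace_Rn] x)
    finally show \<dots> .
  qed
  moreover have "v = w"
    if w: "w \<in> Rn n" "(f has_derivative (\<lambda>h. inner w h)) (at x within Rn n)"
      and v: "v \<in> Rn n" "(f has_derivative (\<lambda>h. inner v h)) (at x within Rn n)" for v w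
  proof -
    define d where "d = v - w"
    have d: "d \<in> Rn n" using v w by (simp add: d_def subspace_diff[OF subspace_Rn])
    have "((\<lambda>y. f y - f y) has_derivative (\<lambda>h. inner v h - inner w h)) (at x within Rn n)"
      by (rule has_derivative_diff) (fact v w)+
    then have "((\<lambda>y. 0 :: real) has_derivative (\<lambda>h. inner d h)) (at x within Rn n)"
      by (simp add: d_def inner_diff_left)
    then have "((\<lambda>y. 0 :: real) has_derivative (\<lambda>h. inner d h))
        (at (x + (0::real) *\<^sub>R d) within range (\<lambda>t. x + t *\<^sub>R d))"
      using x d by (auto intro!: has_derivative_subset[where s = "Rn n"]
          subspace_add[OF subspace_Rn] subspace_scale[OF subspace_Rn])
    moreover have "((\<lambda>t::real. x + t *\<^sub>R d) has_derivative (\<lambda>t. t *\<^sub>R d)) (at 0)"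
      by (auto intro!: derivative_eq_intros)
    ultimately have "((\<lambda>t::real. 0 :: real) has_derivative (\<lambda>t. inner d (t *\<^sub>R d))) (at 0)"
      by (rule has_derivative_in_compose[rotated])
    then have "(\<lambda>t. inner d (t *\<^sub>R d)) = (\<lambda>t. 0)"
      by (rule has_derivative_unique) simp
    from fun_cong[OF this, of 1] show "v = w" by (simp add: d_def)
  qed
  ultimately show ?thesis using v by blast
qed

definition strongly_convex_on :: "'a::real_inner set \<Rightarrow> real \<Rightarrow> ('a \<Rightarrow> real) \<Rightarrow> bool" where
  "strongly_convex_on S \<mu> F \<longleftrightarrow> convex S \<and>
    (\<forall>x\<in>S. \<forall>y\<in>S. \<forall>u\<ge>0. \<forall>v\<ge>0. u + v = 1 \<longrightarrow>
      F (u *\<^sub>R x + v *\<^sub>R y) \<le> u * F x + v * F y - \<mu> / 2 * u * v * (norm (x - y))\<^sup>2)"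

definition convex_smooth :: "nat \<Rightarrow> real \<Rightarrow> (fseq \<Rightarrow> real) \<Rightarrow> bool" where
  "convex_smooth n L f \<longleftrightarrow>
    convex_on (Rn n) f \<and> f differentiable_on Rn n \<and> L-lipschitz_on (Rn n) (grad n f)"

definition objective :: "nat \<Rightarrow> (fseq \<Rightarrow> real) \<Rightarrow> (nat \<Rightarrow> fseq \<Rightarrow> real) \<Rightarrow> fseq \<Rightarrow> real" where
  "objective m f g x = f x + 1 / real m * (\<Sum>k=1..m. g k x)"

definition composite_problem ::
    "nat \<Rightarrow> nat \<Rightarrow> real \<Rightarrow> real \<Rightarrow> real \<Rightarrow> (fseq \<Rightarrow> real) \<Rightarrow> (nat \<Rightarrow> fseq \<Rightarrow> real) \<Rightarrow> bool" where
  "composite_problem n m L\<^sub>f L\<^sub>g \<mu> f g \<longleftrightarrow>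
    1 \<le> n \<and> 1 \<le> m \<and> 0 < \<mu> \<and>
    convex_smooth n L\<^sub>f f \<and> (\<forall>k\<in>{1..m}. convex_smooth n L\<^sub>g (g k)) \<and>
    strongly_convex_on (Rn n) \<mu> (objective m f g)"

text \<open>
  For a problem in the class the minimum over \<open>\<real>\<^sup>n\<close> exists (the objective is continuous and
  strongly convex), so the infimum is the minimum.
\<close>

definition min_value :: "nat \<Rightarrow> (fseq \<Rightarrow> real) \<Rightarrow> real" where
  "min_value n F = (INF x\<in>Rn n. F x)"

section \<open>Randomized first-order algorithms\<close>

text \<open>
  A run of an algorithm is a terminating interaction: it asks for \<open>\<nabla>f\<close> at a point, asks for
  \<open>\<nabla>g\<^sub>k\<close> for one index at a point, draws a random number, or outputs a point. Each
  continuation depends on the oracle answers and random draws obtained so far and on nothing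
  else about \<open>f\<close> and \<open>g\<close>.
\<close>

datatype algorithm =
    Output fseq
  | Grad_f fseq "fseq \<Rightarrow> algorithm"
  | Grad_g nat fseq "fseq \<Rightarrow> algorithm"
  | Draw "nat pmf" "nat \<Rightarrow> algorithm"

text \<open>
  The joint distribution of the output point, the number of computations of \<open>\<nabla>f\<close>, and the
  total number, over all \<open>k\<close>, of computations of gradients \<open>\<nabla>g\<^sub>k\<close>.
\<close>

primrec run ::
    "(fseq \<Rightarrow> fseq) \<Rightarrow> (nat \<Rightarrow> fseq \<Rightarrow> fseq) \<Rightarrow> algorithm \<Rightarrow> (fseq \<times> nat \<times> nat) pmf" where
  "run df dg (Output x) = return_pmf (x, 0, 0)"
| "run df dg (Grad_f x cont) = map_pmf (\<lambda>(y, a, b). (y, Suc a, b)) (run df dg (cont (df x)))"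
| "run df dg (Grad_g k x cont) = map_pmf (\<lambda>(y, a, b). (y, a, Suc b)) (run df dg (cont (dg k x)))"
| "run df dg (Draw p cont) = bind_pmf p (\<lambda>i. run df dg (cont i))"

text \<open>
  Queries must be at points of \<open>\<real>\<^sup>n\<close> and at indices in \<open>{1..m}\<close>, and outputs must lie in
  \<open>\<real>\<^sup>n\<close>, along every run that has positive probability.
\<close>

primrec admissible ::
    "nat \<Rightarrow> nat \<Rightarrow> (fseq \<Rightarrow> fseq) \<Rightarrow> (nat \<Rightarrow> fseq \<Rightarrow> fseq) \<Rightarrow> algorithm \<Rightarrow> bool" where
  "admissible n m df dg (Output x) \<longleftrightarrow> x \<in> Rn n"
| "admissible n m df dg (Grad_f x cont) \<longleftrightarrow> x \<in> Rn n \<and> admissible n m df dg (cont (df x))"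
| "admissible n m df dg (Grad_g k x cont) \<longleftrightarrow>
    k \<in> {1..m} \<and> x \<in> Rn n \<and> admissible n m df dg (cont (dg k x))"
| "admissible n m df dg (Draw p cont) \<longleftrightarrow> (\<forall>i\<in>set_pmf p. admissible n m df dg (cont i))"

text \<open>
  Integrability is required explicitly because the expectation of a non-integrable function is
  \<open>0\<close> by convention.
\<close>

definition solves :: "nat \<Rightarrow> (fseq \<Rightarrow> real) \<Rightarrow> real \<Rightarrow> (fseq \<times> nat \<times> nat) pmf \<Rightarrow> bool" where
  "solves n F \<epsilon> R \<longleftrightarrow>
    integrable (measure_pmf R) (\<lambda>(x, a, b). F x) \<and>
    measure_pmf.expectation R (\<lambda>(x, a, b). F x) - min_value n F \<le> \<epsilon>"

text \<open>
  The factor hidden in the soft-O notation. A product of powers of logarithms of the four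
  quantities is at most a power of \<open>log_factor\<close>.
\<close>

definition log_factor :: "real \<Rightarrow> real \<Rightarrow> nat \<Rightarrow> real \<Rightarrow> real" where
  "log_factor \<kappa>\<^sub>f \<kappa>\<^sub>g m r = ln (exp 1 + \<kappa>\<^sub>f + \<kappa>\<^sub>g + real m + r)"

end

theory Submission
  imports Defs
begin

text \<open>
  The method is gradient sliding with two nested accelerations around a variance-reduced stochastic
  gradient method. An outer accelerated proximal gradient loop linearizes \<open>f\<close> and needs about
  \<open>sqrt (Lf / \<mu>)\<close> steps, each with one gradient of \<open>f\<close>. Its subproblem, the average of the \<open>g k\<close> plus
  a quadratic of curvature \<open>Lf\<close>, is solved by an accelerated proximal point loop with proximal
  curvature \<open>\<kappa> = 2 Lg / m\<close>, in about \<open>sqrt (\<kappa> / Lf)\<close> steps. The innermost problems have condition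
  number of order \<open>m\<close>, and a stochastic epoch with \<open>O(m)\<close> evaluations of summand gradients halves
  their gap (\<open>svrg_epoch_contracts\<close>). Multiplying, the summand gradients number about
  \<open>sqrt (Lf / \<mu>) * sqrt (Lg / (m Lf)) * m = sqrt (m Lg / \<mu>)\<close>, up to logarithms.

  Both accelerated loops are instances of one lemma, \<open>accel_alg_contracts\<close>: the proximal point loop is the
  case of vanishing smooth part. Two features of that lemma make the nesting work. It uses strong
  convexity of the sum alone, since neither \<open>f\<close> nor the average need be strongly convex. And it
  tolerates subproblem solvers with a fixed relative accuracy in expectation: the gap of the
  subproblem at the previous iterate is bounded by the potential of the method
  (\<open>accel_warm_start\<close>), so a relative error of order \<open>\<tau>\<^sup>2\<close> in the subproblem costs
  only half of the contraction of a step (\<open>accel_step\<close>). Hence each level turns an expected contraction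
  of the gap below it into one of its own, with step numbers that depend neither on the random
  draws nor on the current point; the bounds on the oracle counts are deterministic, and the logarithms come
  from the accuracies requested of the two inner levels and from the final accuracy.

  Only the outermost step number involves \<open>\<epsilon>\<close>. It is chosen after one full gradient at the starting
  point, which determines the initial gap up to the condition number (\<open>gap_gradient_bounds\<close>).
\<close>

section \<open>Tangent bounds and strong convexity\<close>

text \<open>
  The form in which gradients enter all estimates below: the graph of \<open>h\<close> lies between its tangents and the tangent paraboloids of curvature \<open>L\<close>. Keeping the
  gradient as a separate function \<open>G\<close> makes sums, averages and added quadratics immediate.
\<close>

definition tangent_bounds ::
    "'a::real_inner set \<Rightarrow> real \<Rightarrow> ('a \<Rightarrow> real) \<Rightarrow> ('a \<Rightarrow> 'a) \<Rightarrow> bool" where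
  "tangent_bounds V L h G \<longleftrightarrow> (\<forall>x\<in>V. G x \<in> V) \<and>
    (\<forall>x\<in>V. \<forall>y\<in>V. h x + inner (G x) (y - x) \<le> h y \<and>
      h y \<le> h x + inner (G x) (y - x) + L / 2 * (norm (y - x))\<^sup>2)"

lemma tangent_boundsD:
  assumes "tangent_bounds V L h G" "x \<in> V"
  shows "G x \<in> V"
    and "y \<in> V \<Longrightarrow> h x + inner (G x) (y - x) \<le> h y"
    and "y \<in> V \<Longrightarrow> h y \<le> h x + inner (G x) (y - x) + L / 2 * (norm (y - x))\<^sup>2"
  using assms by (auto simp: tangent_bounds_def)

lemma norm_sq_add_scaled:
  fixes x d :: "'a::real_inner"
  shows "(norm (x + t *\<^sub>R d))\<^sup>2 = (norm x)\<^sup>2 + 2 * t * inner x d + t\<^sup>2 * (norm d)\<^sup>2"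
  by (simp add: power2_norm_eq_inner inner_add_left inner_add_right inner_commute
      power2_eq_square[of t] algebra_simps)

lemma tangent_bounds_add:
  assumes "subspace V" "tangent_bounds V L h G" "tangent_bounds V L' h' G'"
  shows "tangent_bounds V (L + L') (\<lambda>x. h x + h' x) (\<lambda>x. G x + G' x)"
  unfolding tangent_bounds_def
proof (intro conjI ballI)
  fix x y assume xy: "x \<in> V" "y \<in> V"
  note b = tangent_boundsD[OF assms(2) xy(1)] tangent_boundsD[OF assms(3) xy(1)]
  show "G x + G' x \<in> V" using b assms(1) by (simp add: subspace_add)
  show "h x + h' x + inner (G x + G' x) (y - x) \<le> h y + h' y"
    using b(2)[OF xy(2)] b(5)[OF xy(2)] by (simp add: inner_add_left)
  show "h y + h' y \<le> h x + h' x + inner (G x + G' x) (y - x) + (L + L') / 2 * (norm (y - x))\<^sup>2"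
    using b(3)[OF xy(2)] b(6)[OF xy(2)] by (simp add: inner_add_left algebra_simps add_divide_distrib)
qed

lemma tangent_bounds_quadratic:
  fixes c :: "'a::real_inner"
  assumes "subspace V" "c \<in> V" "0 \<le> s"
  shows "tangent_bounds V s (\<lambda>x. inner c x + s / 2 * (norm x)\<^sup>2) (\<lambda>x. c + s *\<^sub>R x)"
  unfolding tangent_bounds_def
proof (intro conjI ballI)
  fix x y assume xy: "x \<in> V" "y \<in> V"
  show "c + s *\<^sub>R x \<in> V" using assms xy by (simp add: subspace_add subspace_scale)
  have eq: "inner c y + s / 2 * (norm y)\<^sup>2 =
      inner c x + s / 2 * (norm x)\<^sup>2 + inner (c + s *\<^sub>R x) (y - x) + s / 2 * (norm (y - x))\<^sup>2"
    by (simp add: power2_norm_eq_inner algebra_simps inner_commute)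
  then show "inner c y + s / 2 * (norm y)\<^sup>2 \<le>
      inner c x + s / 2 * (norm x)\<^sup>2 + inner (c + s *\<^sub>R x) (y - x) + s / 2 * (norm (y - x))\<^sup>2"
    by simp
  have "0 \<le> s / 2 * (norm (y - x))\<^sup>2" using assms by simp
  then show "inner c x + s / 2 * (norm x)\<^sup>2 + inner (c + s *\<^sub>R x) (y - x)
      \<le> inner c y + s / 2 * (norm y)\<^sup>2"
    using eq by linarith
qed

lemma tangent_bounds_average:
  fixes m :: nat
  assumes V: "subspace V" and "1 \<le> m" and h: "\<And>k. k \<in> {1..m} \<Longrightarrow> tangent_bounds V L (h k) (G k)"
  shows "tangent_bounds V L (\<lambda>x. 1 / real m * (\<Sum>k=1..m. h k x))
           (\<lambda>x. (1 / real m) *\<^sub>R (\<Sum>k=1..m. G k x))"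
  unfolding tangent_bounds_def
proof (intro conjI ballI)
  fix x y assume xy: "x \<in> V" "y \<in> V"
  have m: "real m > 0" using assms(2) by simp
  show "(1 / real m) *\<^sub>R (\<Sum>k=1..m. G k x) \<in> V"
    using tangent_boundsD(1)[OF h xy(1)] by (intro subspace_scale[OF V] subspace_sum[OF V]) auto
  have "(\<Sum>k=1..m. h k x + inner (G k x) (y - x)) \<le> (\<Sum>k=1..m. h k y)"
    by (intro sum_mono tangent_boundsD(2)[OF h]) (use xy in auto)
  then have "(1 / real m) * ((\<Sum>k=1..m. h k x) + inner (\<Sum>k=1..m. G k x) (y - x))
      \<le> (1 / real m) * (\<Sum>k=1..m. h k y)"
    using m by (intro mult_left_mono) (auto simp: sum.distrib inner_sum_left)
  then show "1 / real m * (\<Sum>k=1..m. h k x) + inner ((1 / real m) *\<^sub>R (\<Sum>k=1..m. G k x)) (y - x)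
      \<le> 1 / real m * (\<Sum>k=1..m. h k y)"
    by (simp add: distrib_left add_divide_distrib)
  have "(\<Sum>k=1..m. h k y) \<le> (\<Sum>k=1..m. h k x + inner (G k x) (y - x) + L / 2 * (norm (y - x))\<^sup>2)"
    by (intro sum_mono tangent_boundsD(3)[OF h]) (use xy in auto)
  then have "(1 / real m) * (\<Sum>k=1..m. h k y) \<le> (1 / real m) *
      ((\<Sum>k=1..m. h k x) + inner (\<Sum>k=1..m. G k x) (y - x) + real m * (L / 2 * (norm (y - x))\<^sup>2))"
    using m by (intro mult_left_mono) (auto simp: sum.distrib inner_sum_left)
  then show "1 / real m * (\<Sum>k=1..m. h k y) \<le> 1 / real m * (\<Sum>k=1..m. h k x) +
      inner ((1 / real m) *\<^sub>R (\<Sum>k=1..m. G k x)) (y - x) + L / 2 * (norm (y - x))\<^sup>2"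
    using m by (simp add: distrib_left add_divide_distrib)
qed

text \<open>
  Along the segment from \<open>x\<close> to \<open>y\<close> the support inequality bounds \<open>h\<close> from below and strong
  convexity bounds it from above; dividing by the step \<open>t\<close> and letting \<open>t\<close> tend to \<open>0\<close> leaves
  the quadratic term. The case \<open>p = 0\<close> is quadratic growth around a minimizer.
\<close>

lemma strongly_convex_on_lower:
  fixes h :: "'a::real_inner \<Rightarrow> real"
  assumes sc: "strongly_convex_on V \<sigma> h" and x: "x \<in> V" and y: "y \<in> V"
    and supp: "\<And>w. w \<in> V \<Longrightarrow> h x + inner p (w - x) \<le> h w"
  shows "h x + inner p (y - x) + \<sigma> / 2 * (norm (y - x))\<^sup>2 \<le> h y"
proof -
  define D where "D = h y - h x - inner p (y - x)"
  define B where "B = \<sigma> / 2 * (norm (y - x))\<^sup>2"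
  have le: "(1 - t) * B \<le> D" if t: "0 < t" "t < 1" for t
  proof -
    let ?w = "(1 - t) *\<^sub>R x + t *\<^sub>R y"
    have "convex V" using sc by (simp add: strongly_convex_on_def)
    then have "?w \<in> V" using x y t by (intro convexD) auto
    then have 1: "h x + inner p (?w - x) \<le> h ?w" by (rule supp)
    have 2: "h ?w \<le> (1 - t) * h x + t * h y - \<sigma> / 2 * (1 - t) * t * (norm (x - y))\<^sup>2"
      using sc x y t by (simp add: strongly_convex_on_def)
    have "?w - x = t *\<^sub>R (y - x)" by (simp add: algebra_simps)
    then have "h x + t * inner p (y - x) \<le> (1 - t) * h x + t * h y - (1 - t) * t * B"
      using 1 2 by (simp add: B_def norm_minus_commute algebra_simps)
    then have "t * ((1 - t) * B) \<le> t * D" by (simp add: D_def algebra_simps)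
    then show ?thesis using t by simp
  qed
  have "((\<lambda>t. (1 - t) * B) \<longlongrightarrow> (1 - 0) * B) (at_right (0::real))"
    by (intro tendsto_intros)
  moreover have "\<forall>\<^sub>F t in at_right (0::real). (1 - t) * B \<le> D"
    using le by (intro eventually_at_rightI[of 0 1]) auto
  ultimately have "(1 - 0) * B \<le> D"
    by (intro tendsto_upperbound[where F = "at_right (0::real)"]) auto
  then show ?thesis by (simp add: B_def D_def)
qed

lemma strongly_convex_on_growth:
  fixes h :: "'a::real_inner \<Rightarrow> real"
  assumes "strongly_convex_on V \<sigma> h" "x \<in> V" "\<And>w. w \<in> V \<Longrightarrow> h x \<le> h w" "y \<in> V"
  shows "h x + \<sigma> / 2 * (norm (y - x))\<^sup>2 \<le> h y"
  using strongly_convex_on_lower[OF assms(1,2,4), of 0] assms(3) by simp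

lemma strongly_convex_on_quadratic:
  fixes \<psi> :: "'a::real_inner \<Rightarrow> real"
  assumes "convex_on V \<psi>"
  shows "strongly_convex_on V s (\<lambda>x. \<psi> x + (inner c x + s / 2 * (norm x)\<^sup>2))"
  unfolding strongly_convex_on_def
proof (intro conjI ballI allI impI)
  show "convex V" using assms by (rule convex_on_imp_convex)
  fix x y u v assume xy: "x \<in> V" "y \<in> V" and uv: "0 \<le> (u::real)" "0 \<le> v" "u + v = 1"
  have 1: "\<psi> (u *\<^sub>R x + v *\<^sub>R y) \<le> u * \<psi> x + v * \<psi> y"
    using assms xy uv by (simp add: convex_on_def)
  have u: "u = 1 - v" using uv by simp
  have 2: "(norm (u *\<^sub>R x + v *\<^sub>R y))\<^sup>2 =
      u * (norm x)\<^sup>2 + v * (norm y)\<^sup>2 - u * v * (norm (x - y))\<^sup>2"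
    unfolding u by (simp add: power2_norm_eq_inner algebra_simps inner_commute)
  have 3: "s / 2 * (norm (u *\<^sub>R x + v *\<^sub>R y))\<^sup>2 =
      u * (s / 2 * (norm x)\<^sup>2) + v * (s / 2 * (norm y)\<^sup>2) - s / 2 * u * v * (norm (x - y))\<^sup>2"
    unfolding 2 by (simp add: algebra_simps)
  show "\<psi> (u *\<^sub>R x + v *\<^sub>R y) + (inner c (u *\<^sub>R x + v *\<^sub>R y) + s / 2 * (norm (u *\<^sub>R x + v *\<^sub>R y))\<^sup>2)
      \<le> u * (\<psi> x + (inner c x + s / 2 * (norm x)\<^sup>2)) + v * (\<psi> y + (inner c y + s / 2 * (norm y)\<^sup>2))
        - s / 2 * u * v * (norm (x - y))\<^sup>2"
    using 1 unfolding 3 by (simp only: inner_add_right inner_scaleR_right distrib_left)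
qed

lemma strongly_convex_on_add_const:
  "strongly_convex_on V \<sigma> h \<Longrightarrow> strongly_convex_on V \<sigma> (\<lambda>x. h x + b)"
  unfolding strongly_convex_on_def
proof (elim conjE, intro conjI ballI allI impI, assumption)
  fix x y u v assume "\<forall>x\<in>V. \<forall>y\<in>V. \<forall>u\<ge>0. \<forall>v\<ge>0. u + v = 1 \<longrightarrow>
      h (u *\<^sub>R x + v *\<^sub>R y) \<le> u * h x + v * h y - \<sigma> / 2 * u * v * (norm (x - y))\<^sup>2"
    and A: "x \<in> V" "y \<in> V" "0 \<le> (u::real)" "0 \<le> v" "u + v = 1"
  then have "h (u *\<^sub>R x + v *\<^sub>R y) \<le> u * h x + v * h y - \<sigma> / 2 * u * v * (norm (x - y))\<^sup>2"
    by blast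
  moreover have "b = u * b + v * b" using A by (metis distrib_right mult_1)
  ultimately show "h (u *\<^sub>R x + v *\<^sub>R y) + b
      \<le> u * (h x + b) + v * (h y + b) - \<sigma> / 2 * u * v * (norm (x - y))\<^sup>2"
    by (simp add: distrib_left)
qed

lemma strongly_convex_on_mono:
  assumes "strongly_convex_on V \<sigma> h" "\<sigma>' \<le> \<sigma>"
  shows "strongly_convex_on V \<sigma>' h"
  unfolding strongly_convex_on_def
proof (intro conjI ballI allI impI)
  show "convex V" using assms(1) by (simp add: strongly_convex_on_def)
  fix x y u v assume A: "x \<in> V" "y \<in> V" "0 \<le> (u::real)" "0 \<le> v" "u + v = 1"
  then have "h (u *\<^sub>R x + v *\<^sub>R y) \<le> u * h x + v * h y - \<sigma> / 2 * u * v * (norm (x - y))\<^sup>2"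
    using assms(1) by (simp add: strongly_convex_on_def)
  moreover have "\<sigma>' / 2 * u * v * (norm (x - y))\<^sup>2 \<le> \<sigma> / 2 * u * v * (norm (x - y))\<^sup>2"
    using A assms(2) by (intro mult_right_mono) auto
  ultimately show "h (u *\<^sub>R x + v *\<^sub>R y) \<le> u * h x + v * h y - \<sigma>' / 2 * u * v * (norm (x - y))\<^sup>2"
    by linarith
qed

text \<open>
  Compare the tangent at \<open>y\<close> and the paraboloid at \<open>x\<close> in the point reached from \<open>x\<close> by a step of
  length \<open>1 / L\<close> against the difference of the gradients.
\<close>

lemma tangent_bounds_cocoercive:
  assumes V: "subspace V" and h: "tangent_bounds V L h G" and L: "0 < L"
    and x: "x \<in> V" and y: "y \<in> V"
  shows "(norm (G x - G y))\<^sup>2 \<le> 2 * L * (h x - h y - inner (G y) (x - y))"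
proof -
  define e where "e = G x - G y"
  define z where "z = x - (1 / L) *\<^sub>R e"
  have z: "z \<in> V"
    using V x y tangent_boundsD(1)[OF h] by (simp add: z_def e_def subspace_diff subspace_scale)
  have 1: "h y + inner (G y) (z - y) \<le> h z" by (rule tangent_boundsD(2)[OF h y z])
  have 2: "h z \<le> h x + inner (G x) (z - x) + L / 2 * (norm (z - x))\<^sup>2"
    by (rule tangent_boundsD(3)[OF h x z])
  have "L / 2 * (norm (z - x))\<^sup>2 = (norm e)\<^sup>2 / (2 * L)"
    using L by (simp add: z_def power_divide power2_eq_square field_simps)
  moreover have "inner (G x) (z - x) - inner (G y) (z - x) = - ((norm e)\<^sup>2 / L)"
    using L by (simp add: z_def power2_norm_eq_inner) (simp add: e_def inner_diff_left diff_divide_distrib)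
  moreover have "inner (G y) (z - y) = inner (G y) (z - x) + inner (G y) (x - y)"
    by (simp add: inner_diff_right)
  ultimately have "(norm e)\<^sup>2 / L - (norm e)\<^sup>2 / (2 * L) \<le> h x - h y - inner (G y) (x - y)"
    using 1 2 by linarith
  moreover have "(norm e)\<^sup>2 / L - (norm e)\<^sup>2 / (2 * L) = (norm e)\<^sup>2 / (2 * L)"
    using L by (simp add: field_simps)
  ultimately show ?thesis using L by (simp add: e_def[symmetric] field_simps)
qed

text \<open>
  The gradient step of length \<open>1 / L\<close> is a contraction, by cocoercivity and strong monotonicity
  of the gradient, and its fixed point is a zero of the gradient. The ambient space
  \<^typ>\<open>fseq\<close> is not complete, but the coordinate subspaces are, and Banach's theorem needs
  completeness of the subspace only.
\<close>

lemma ex_minimizer: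
  assumes V: "subspace V" "complete V" and h: "tangent_bounds V L h G"
    and sc: "strongly_convex_on V \<sigma> h" and pos: "0 < \<sigma>" "0 < L"
  obtains v where "v \<in> V" "G v = 0" "\<And>u. u \<in> V \<Longrightarrow> h v \<le> h u"
proof -
  define T where "T x = x - (1 / L) *\<^sub>R G x" for x
  define q where "q = max 0 (1 - \<sigma> / L)"
  have q: "0 \<le> q" "q < 1" using pos by (auto simp: q_def)
  have contr: "dist (T x) (T y) \<le> sqrt q * dist x y" if xy: "x \<in> V" "y \<in> V" for x y
  proof -
    define e where "e = G x - G y"
    define d where "d = x - y"
    have c1: "(norm e)\<^sup>2 \<le> 2 * L * (h x - h y - inner (G y) d)"
      and c2: "(norm e)\<^sup>2 \<le> 2 * L * (h y - h x + inner (G x) d)"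
      using tangent_bounds_cocoercive[OF V(1) h pos(2) xy]
        tangent_bounds_cocoercive[OF V(1) h pos(2) xy(2,1)]
      by (auto simp: e_def d_def norm_minus_commute inner_diff_right algebra_simps)
    have s1: "h x + inner (G x) (y - x) + \<sigma> / 2 * (norm (y - x))\<^sup>2 \<le> h y"
      by (rule strongly_convex_on_lower[OF sc xy]) (rule tangent_boundsD(2)[OF h xy(1)])
    have s2: "h y + inner (G y) (x - y) + \<sigma> / 2 * (norm (x - y))\<^sup>2 \<le> h x"
      by (rule strongly_convex_on_lower[OF sc xy(2,1)]) (rule tangent_boundsD(2)[OF h xy(2)])
    have ed: "inner e d = inner (G x) d - inner (G y) d" by (simp add: e_def inner_diff_left)
    have "inner (G x) (y - x) = - inner (G x) d" by (simp add: d_def inner_diff_right)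
    then have mono: "\<sigma> * (norm d)\<^sup>2 \<le> inner e d"
      using s1 s2 ed by (simp add: d_def norm_minus_commute)
    have "2 * L * (h x - h y - inner (G y) d) + 2 * L * (h y - h x + inner (G x) d) = 2 * L * inner e d"
      by (simp add: ed algebra_simps)
    then have coco: "(norm e)\<^sup>2 \<le> L * inner e d" using c1 c2 by linarith
    have "T x - T y = d + (- (1 / L)) *\<^sub>R e" by (simp add: T_def d_def e_def algebra_simps)
    then have "(norm (T x - T y))\<^sup>2 = (norm d)\<^sup>2 - 2 / L * inner e d + (1 / L)\<^sup>2 * (norm e)\<^sup>2"
      by (simp only: norm_sq_add_scaled) (simp add: inner_commute)
    also have "(1 / L)\<^sup>2 * (norm e)\<^sup>2 \<le> (1 / L)\<^sup>2 * (L * inner e d)"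
      using coco by (intro mult_left_mono) auto
    also have "(norm d)\<^sup>2 - 2 / L * inner e d + (1 / L)\<^sup>2 * (L * inner e d) = (norm d)\<^sup>2 - inner e d / L"
      using pos by (simp add: power2_eq_square field_simps)
    also have "\<dots> \<le> (norm d)\<^sup>2 - \<sigma> * (norm d)\<^sup>2 / L"
      using mono pos by (simp add: divide_right_mono)
    also have "\<dots> = (1 - \<sigma> / L) * (norm d)\<^sup>2" by (simp add: algebra_simps)
    also have "\<dots> \<le> q * (norm d)\<^sup>2" by (intro mult_right_mono) (auto simp: q_def)
    also have "\<dots> = (sqrt q * norm d)\<^sup>2" using q by (simp add: power_mult_distrib)
    finally have "norm (T x - T y) \<le> sqrt q * norm d"
      by (rule power2_le_imp_le) (use q in auto)
    then show ?thesis by (simp only: dist_norm d_def)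
  qed
  have "\<exists>!x\<in>V. T x = x"
  proof (rule Banach_fix[where c = "sqrt q"])
    show "V \<noteq> {}" using subspace_0[OF V(1)] by blast
    show "T ` V \<subseteq> V"
      using tangent_boundsD(1)[OF h] V(1) by (auto simp: T_def intro!: subspace_diff subspace_scale)
  qed (use V q contr in auto)
  then obtain v where v: "v \<in> V" "T v = v" by blast
  then have "G v = 0" using pos by (simp add: T_def)
  moreover from this v have "h v \<le> h u" if "u \<in> V" for u
    using tangent_boundsD(2)[OF h v(1) that] by simp
  ultimately show ?thesis using v that by blast
qed

section \<open>Gradients on the coordinate subspaces\<close>

lemma abs_coord_le_norm: "\<bar>coord x i\<bar> \<le> norm x"
proof -
  have "(coord x i)\<^sup>2 \<le> (\<Sum>j\<in>insert i {j. coord x j \<noteq> 0}. coord x j * coord x j)"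
    unfolding power2_eq_square by (rule member_le_sum) auto
  also have "\<dots> = inner x x" by (rule inner_fseq_superset[symmetric]) auto
  finally have "(coord x i)\<^sup>2 \<le> inner x x" .
  then show ?thesis by (metis norm_eq_sqrt_inner real_sqrt_abs real_sqrt_le_iff)
qed

lemma complete_Rn: "complete (Rn n)"
  unfolding complete_def
proof (intro allI impI)
  fix X :: "nat \<Rightarrow> fseq" assume X: "(\<forall>k. X k \<in> Rn n) \<and> Cauchy X"
  have "Cauchy (\<lambda>k. coord (X k) i)" for i
    unfolding Cauchy_def
  proof (intro allI impI)
    fix e :: real assume "0 < e"
    then obtain M where M: "\<And>j k. M \<le> j \<Longrightarrow> M \<le> k \<Longrightarrow> dist (X j) (X k) < e"
      using X unfolding Cauchy_def by blast
    have "dist (coord (X j) i) (coord (X k) i) \<le> dist (X j) (X k)" for j k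
      using abs_coord_le_norm[of "X j - X k" i] by (simp add: dist_norm)
    then show "\<exists>M. \<forall>j\<ge>M. \<forall>k\<ge>M. dist (coord (X j) i) (coord (X k) i) < e"
      using M le_less_trans by (intro exI[of _ M]) blast
  qed
  then have lim: "(\<lambda>k. coord (X k) i) \<longlonglongrightarrow> lim (\<lambda>k. coord (X k) i)" for i
    by (simp add: Cauchy_convergent_iff convergent_LIMSEQ_iff)
  define l where "l i = lim (\<lambda>k. coord (X k) i)" for i
  have l0: "l i = 0" if "n \<le> i" for i
  proof -
    have "(\<lambda>k. coord (X k) i) = (\<lambda>k. 0)" using X that by (auto simp: Rn_def)
    then show ?thesis by (simp add: l_def limI)
  qed
  then have "{i. l i \<noteq> 0} \<subseteq> {..<n}" by (auto simp: not_le[symmetric])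
  then have cl: "coord (Abs_fseq l) = l" by (simp add: Abs_fseq_inverse finite_subset)
  then have a: "Abs_fseq l \<in> Rn n" using l0 by (simp add: Rn_def)
  have norm: "norm (X k - Abs_fseq l) = sqrt (\<Sum>i<n. (coord (X k) i - l i)\<^sup>2)" for k
    using X a by (simp add: norm_eq_sqrt_inner inner_Rn[where n = n] subspace_diff[OF subspace_Rn]
        cl power2_eq_square)
  have "(\<lambda>k. sqrt (\<Sum>i<n. (coord (X k) i - l i)\<^sup>2)) \<longlonglongrightarrow> sqrt (\<Sum>i<n. (l i - l i)\<^sup>2)"
    using lim by (intro tendsto_intros) (simp add: l_def)
  then have "X \<longlonglongrightarrow> Abs_fseq l"
    by (subst LIM_zero_iff[symmetric], subst tendsto_norm_zero_iff[symmetric]) (simp add: norm)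
  then show "\<exists>l\<in>Rn n. X \<longlonglongrightarrow> l" using a by blast
qed

text \<open>
  Both bounds follow from one-dimensional calculus along the line through \<open>x\<close> and \<open>y\<close>, which stays
  inside the subspace, so derivatives within the subspace are genuine derivatives in the parameter.
\<close>

lemma convex_smooth_tangent_bounds:
  assumes f: "convex_smooth n L f"
  shows "tangent_bounds (Rn n) L f (grad n f)"
proof -
  have grad: "grad n f x \<in> Rn n \<and>
      (f has_derivative (\<lambda>h. inner (grad n f x) h)) (at x within Rn n)" if "x \<in> Rn n" for x
    unfolding grad_def
    by (rule theI', rule ex1_grad) (use f that in \<open>auto simp: convex_smooth_def differentiable_on_def\<close>)
  have "f x + inner (grad n f x) (y - x) \<le> f y \<and>
      f y \<le> f x + inner (grad n f x) (y - x) + L / 2 * (norm (y - x))\<^sup>2"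
    if xy: "x \<in> Rn n" "y \<in> Rn n" for x y
  proof
    define d where "d = y - x"
    define p where "p t = x + t *\<^sub>R d" for t :: real
    have p: "p t \<in> Rn n" for t
      using xy by (auto simp: p_def d_def intro!: subspace_add[OF subspace_Rn]
          subspace_scale[OF subspace_Rn] subspace_diff[OF subspace_Rn])
    have der: "((\<lambda>t. f (p t)) has_real_derivative inner (grad n f (p t)) d) (at t)" for t
    proof -
      have "(f has_derivative (\<lambda>h. inner (grad n f (p t)) h)) (at (p t) within range p)"
        using grad[OF p] p by (auto intro: has_derivative_subset)
      moreover have "(p has_derivative (\<lambda>t. t *\<^sub>R d)) (at t)"
        unfolding p_def by (auto intro!: derivative_eq_intros)
      ultimately have "((\<lambda>t. f (p t)) has_derivative (\<lambda>s. inner (grad n f (p t)) (s *\<^sub>R d))) (at t)"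
        by (rule has_derivative_in_compose[rotated])
      then show ?thesis by (simp add: has_field_derivative_def mult_commute_abs)
    qed
    have "convex_on UNIV (\<lambda>t. f (p t))"
    proof (rule convex_onI)
      fix t a b :: real assume t: "0 < t" "t < 1"
      have "p ((1 - t) *\<^sub>R a + t *\<^sub>R b) = (1 - t) *\<^sub>R p a + t *\<^sub>R p b"
        by (simp add: p_def algebra_simps)
      then show "f (p ((1 - t) *\<^sub>R a + t *\<^sub>R b)) \<le> (1 - t) * f (p a) + t * f (p b)"
        using f p t by (simp add: convex_smooth_def convex_on_def)
    qed simp
    from convex_on_imp_above_tangent[OF this _ _ _ DERIV_subset[OF der[of 0]], of 1]
    have "inner (grad n f (p 0)) d * (1 - 0) \<le> f (p 1) - f (p 0)" by simp
    then show "f x + inner (grad n f x) (y - x) \<le> f y" by (simp add: p_def d_def)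
    let ?\<theta> = "\<lambda>t. f (p t) - t * inner (grad n f x) d - L / 2 * t\<^sup>2 * (norm d)\<^sup>2"
    have "?\<theta> 1 \<le> ?\<theta> 0"
    proof (rule DERIV_nonpos_imp_nonincreasing[of 0 1 ?\<theta>])
      fix t :: real assume t: "0 \<le> t" "t \<le> 1"
      have "(?\<theta> has_real_derivative
          inner (grad n f (p t)) d - inner (grad n f x) d - L * t * (norm d)\<^sup>2) (at t)"
        by (auto intro!: derivative_eq_intros der)
      moreover have "inner (grad n f (p t)) d - inner (grad n f x) d - L * t * (norm d)\<^sup>2 \<le> 0"
      proof -
        have "inner (grad n f (p t) - grad n f x) d \<le> norm (grad n f (p t) - grad n f x) * norm d"
          by (rule norm_cauchy_schwarz)
        also have "norm (grad n f (p t) - grad n f x) \<le> L * norm (p t - x)"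
          using f p xy by (auto simp: convex_smooth_def lipschitz_on_def dist_norm)
        also have "norm (p t - x) = t * norm d" using t by (simp add: p_def)
        finally show ?thesis
          by (simp add: inner_diff_left power2_eq_square mult.assoc mult_right_mono)
      qed
      ultimately show "\<exists>y. (?\<theta> has_real_derivative y) (at t) \<and> y \<le> 0" by blast
    qed simp
    then show "f y \<le> f x + inner (grad n f x) (y - x) + L / 2 * (norm (y - x))\<^sup>2"
      by (simp add: p_def d_def)
  qed
  then show ?thesis using grad by (simp add: tangent_bounds_def)
qed

section \<open>Composing algorithms\<close>

primrec alg_bind :: "algorithm \<Rightarrow> (fseq \<Rightarrow> algorithm) \<Rightarrow> algorithm" where
  "alg_bind (Output x) K = K x"
| "alg_bind (Grad_f x cont) K = Grad_f x (\<lambda>d. alg_bind (cont d) K)"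
| "alg_bind (Grad_g k x cont) K = Grad_g k x (\<lambda>d. alg_bind (cont d) K)"
| "alg_bind (Draw p cont) K = Draw p (\<lambda>i. alg_bind (cont i) K)"

text \<open>
  The expectation of a function of the output, computed by recursion over the interaction tree
  rather than through the distribution of runs. With this definition the rule for sequential
  composition (\<open>expect_bind\<close>) is an equation without integrability conditions.
\<close>

primrec expect ::
    "(fseq \<Rightarrow> fseq) \<Rightarrow> (nat \<Rightarrow> fseq \<Rightarrow> fseq) \<Rightarrow> algorithm \<Rightarrow> (fseq \<Rightarrow> real) \<Rightarrow> real" where
  "expect df dg (Output x) W = W x"
| "expect df dg (Grad_f x cont) W = expect df dg (cont (df x)) W"
| "expect df dg (Grad_g k x cont) W = expect df dg (cont (dg k x)) W"
| "expect df dg (Draw p cont) W = measure_pmf.expectation p (\<lambda>i. expect df dg (cont i) W)"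

text \<open>
  Besides admissibility and worst-case bounds for the two oracle counters, this demands that every
  draw has finite support. The runs are then finitely supported, so all expectations are finite sums.
\<close>

primrec bounded_run :: "nat \<Rightarrow> nat \<Rightarrow> (fseq \<Rightarrow> fseq) \<Rightarrow> (nat \<Rightarrow> fseq \<Rightarrow> fseq) \<Rightarrow> algorithm \<Rightarrow>
    nat \<Rightarrow> nat \<Rightarrow> bool" where
  "bounded_run n m df dg (Output x) a b \<longleftrightarrow> x \<in> Rn n"
| "bounded_run n m df dg (Grad_f x cont) a b \<longleftrightarrow>
    x \<in> Rn n \<and> 0 < a \<and> bounded_run n m df dg (cont (df x)) (a - 1) b"
| "bounded_run n m df dg (Grad_g k x cont) a b \<longleftrightarrow>
    k \<in> {1..m} \<and> x \<in> Rn n \<and> 0 < b \<and> bounded_run n m df dg (cont (dg k x)) a (b - 1)"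
| "bounded_run n m df dg (Draw p cont) a b \<longleftrightarrow>
    finite (set_pmf p) \<and> (\<forall>i\<in>set_pmf p. bounded_run n m df dg (cont i) a b)"

lemma bounded_run_run:
  assumes "bounded_run n m df dg A a b"
  shows "admissible n m df dg A" (is ?adm)
    and "finite (set_pmf (run df dg A))" (is ?fin)
    and "\<forall>(x, a', b')\<in>set_pmf (run df dg A). a' \<le> a \<and> b' \<le> b" (is ?counts)
    and "measure_pmf.expectation (run df dg A) (\<lambda>(x, a, b). W x) = expect df dg A W" (is ?exp)
proof -
  have "?adm \<and> ?fin \<and> ?counts \<and> ?exp"
    using assms
  proof (induction A arbitrary: a b)
    case (Output x)
    then show ?case by simp
  next
    case (Grad_f x cont)
    then have b: "bounded_run n m df dg (cont (df x)) (a - 1) b" and "0 < a" "x \<in> Rn n" by auto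
    from Grad_f.IH[OF rangeI b] this(2,3) show ?case by (fastforce simp: case_prod_unfold)
  next
    case (Grad_g k x cont)
    then have b: "bounded_run n m df dg (cont (dg k x)) a (b - 1)"
      and "0 < b" "x \<in> Rn n" "k \<in> {1..m}" by auto
    from Grad_g.IH[OF rangeI b] this(2-4) show ?case by (fastforce simp: case_prod_unfold)
  next
    case (Draw p cont)
    then have fin: "finite (set_pmf p)"
      and b: "\<And>i. i \<in> set_pmf p \<Longrightarrow> bounded_run n m df dg (cont i) a b" by auto
    note IH = Draw.IH[OF rangeI b]
    have "measure_pmf.expectation (run df dg (Draw p cont)) (\<lambda>(x, a, b). W x) =
        (\<Sum>i\<in>set_pmf p. pmf p i *\<^sub>R measure_pmf.expectation (run df dg (cont i)) (\<lambda>(x, a, b). W x))"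
      using fin IH by (simp add: pmf_expectation_bind[of "set_pmf p"])
    also have "\<dots> = (\<Sum>i\<in>set_pmf p. pmf p i *\<^sub>R expect df dg (cont i) W)"
      by (intro sum.cong refl arg_cong[where f = "scaleR _"]) (use IH in blast)
    also have "\<dots> = expect df dg (Draw p cont) W"
      using fin by (simp add: integral_measure_pmf[of "set_pmf p"])
    finally have e: "measure_pmf.expectation (run df dg (Draw p cont)) (\<lambda>(x, a, b). W x) =
        expect df dg (Draw p cont) W" .
    have "admissible n m df dg (Draw p cont)" "finite (set_pmf (run df dg (Draw p cont)))"
      using fin IH by auto
    moreover have "\<forall>(x, a', b')\<in>set_pmf (run df dg (Draw p cont)). a' \<le> a \<and> b' \<le> b"
      using IH by fastforce
    ultimately show ?case using e by blast
  qed
  then show ?adm ?fin ?counts ?exp by auto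
qed

lemma bounded_run_mono:
  assumes "bounded_run n m df dg A a b" "a \<le> a'" "b \<le> b'"
  shows "bounded_run n m df dg A a' b'"
  using assms
proof (induction A arbitrary: a b a' b')
  case (Grad_f x cont)
  then show ?case using diff_le_mono[of a a' 1] by (auto simp: less_le_trans)
next
  case (Grad_g k x cont)
  then show ?case using diff_le_mono[of b b' 1] by (auto simp: less_le_trans)
qed auto

lemma bounded_run_bind:
  assumes "bounded_run n m df dg A a b" "\<And>x. x \<in> Rn n \<Longrightarrow> bounded_run n m df dg (K x) a' b'"
  shows "bounded_run n m df dg (alg_bind A K) (a + a') (b + b')"
  using assms(1)
proof (induction A arbitrary: a b)
  case (Output x)
  then show ?case using bounded_run_mono[OF assms(2)[of x], of "a + a'" "b + b'"] by simp
next
  case (Grad_f x cont)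
  then have "bounded_run n m df dg (alg_bind (cont (df x)) K) (a - 1 + a') (b + b')"
    by (intro Grad_f.IH[OF rangeI]) auto
  moreover have "a - 1 + a' = a + a' - 1" using Grad_f.prems by auto
  ultimately show ?case using Grad_f.prems by simp
next
  case (Grad_g k x cont)
  then have "bounded_run n m df dg (alg_bind (cont (dg k x)) K) (a + a') (b - 1 + b')"
    by (intro Grad_g.IH[OF rangeI]) auto
  moreover have "b - 1 + b' = b + b' - 1" using Grad_g.prems by auto
  ultimately show ?case using Grad_g.prems by simp
qed auto

lemma expect_bind: "expect df dg (alg_bind A K) W = expect df dg A (\<lambda>x. expect df dg (K x) W)"
  by (induction A) auto

lemma expect_mono:
  assumes "bounded_run n m df dg A a b" "\<And>x. x \<in> Rn n \<Longrightarrow> W x \<le> W' x"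
  shows "expect df dg A W \<le> expect df dg A W'"
  using assms(1)
proof (induction A arbitrary: a b)
  case (Draw p cont)
  then have "finite (set_pmf p)" "\<And>i. i \<in> set_pmf p \<Longrightarrow> expect df dg (cont i) W \<le> expect df dg (cont i) W'"
    by auto
  then show ?case
    by (auto intro!: integral_mono_AE integrable_measure_pmf_finite simp: AE_measure_pmf_iff)
qed (use assms(2) in auto)

lemma expect_affine:
  assumes "bounded_run n m df dg A a b"
  shows "expect df dg A (\<lambda>x. r + q * W x) = r + q * expect df dg A W"
  using assms
proof (induction A arbitrary: a b)
  case (Draw p cont)
  then have fin: "finite (set_pmf p)"
    and IH: "\<And>i. i \<in> set_pmf p \<Longrightarrow>
      expect df dg (cont i) (\<lambda>x. r + q * W x) = r + q * expect df dg (cont i) W"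
    by auto
  have "measure_pmf.expectation p (\<lambda>i. expect df dg (cont i) (\<lambda>x. r + q * W x)) =
      measure_pmf.expectation p (\<lambda>i. r + q * expect df dg (cont i) W)"
    by (rule integral_cong_AE) (auto simp: AE_measure_pmf_iff IH)
  also have "\<dots> = r + q * measure_pmf.expectation p (\<lambda>i. expect df dg (cont i) W)"
    using fin by (simp add: integrable_measure_pmf_finite)
  finally show ?case by simp
qed auto

text \<open>
  The common contract of the three nested methods: started at \<open>w\<close>, the algorithm leaves at
  most the fraction \<open>\<rho>\<close> of the optimality gap of \<open>h\<close>, in expectation. Accuracy is relative to the starting
  gap, so the number of steps, and with it the number of oracle calls, does not depend on \<open>w\<close> or on
  the random draws.
\<close>

definition contracts :: "nat \<Rightarrow> nat \<Rightarrow> (fseq \<Rightarrow> fseq) \<Rightarrow> (nat \<Rightarrow> fseq \<Rightarrow> fseq) \<Rightarrow>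
    (fseq \<Rightarrow> real) \<Rightarrow> real \<Rightarrow> nat \<Rightarrow> nat \<Rightarrow> (fseq \<Rightarrow> algorithm) \<Rightarrow> bool" where
  "contracts n m df dg h \<rho> a b S \<longleftrightarrow> (\<forall>w\<in>Rn n. bounded_run n m df dg (S w) a b \<and>
    (\<forall>v\<in>Rn n. (\<forall>u\<in>Rn n. h v \<le> h u) \<longrightarrow>
      expect df dg (S w) (\<lambda>u. h u - h v) \<le> \<rho> * (h w - h v)))"

lemma contractsD:
  assumes "contracts n m df dg h \<rho> a b S" "w \<in> Rn n"
  shows "bounded_run n m df dg (S w) a b"
    and "v \<in> Rn n \<Longrightarrow> (\<And>u. u \<in> Rn n \<Longrightarrow> h v \<le> h u) \<Longrightarrow>
      expect df dg (S w) (\<lambda>u. h u - h v) \<le> \<rho> * (h w - h v)"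
  using assms by (auto simp: contracts_def)

lemma contractsI:
  assumes "\<And>w. w \<in> Rn n \<Longrightarrow> bounded_run n m df dg (S w) a b"
    and "\<And>w v. w \<in> Rn n \<Longrightarrow> v \<in> Rn n \<Longrightarrow> (\<And>u. u \<in> Rn n \<Longrightarrow> h v \<le> h u) \<Longrightarrow>
      expect df dg (S w) (\<lambda>u. h u - h v) \<le> \<rho> * (h w - h v)"
  shows "contracts n m df dg h \<rho> a b S"
  using assms by (auto simp: contracts_def)

lemma contracts_weaken:
  assumes "contracts n m df dg h \<rho> a b S" "\<rho> \<le> \<rho>'"
  shows "contracts n m df dg h \<rho>' a b S"
proof (rule contractsI)
  fix w assume w: "w \<in> Rn n"
  then show "bounded_run n m df dg (S w) a b" by (rule contractsD(1)[OF assms(1)])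
  fix v assume v: "v \<in> Rn n" "\<And>u. u \<in> Rn n \<Longrightarrow> h v \<le> h u"
  have "expect df dg (S w) (\<lambda>u. h u - h v) \<le> \<rho> * (h w - h v)"
    using contractsD(2)[OF assms(1) w v(1)] v(2) by blast
  also have "\<dots> \<le> \<rho>' * (h w - h v)" using assms(2) v w by (intro mult_right_mono) auto
  finally show "expect df dg (S w) (\<lambda>u. h u - h v) \<le> \<rho>' * (h w - h v)" .
qed

lemma contracts_shift:
  assumes "contracts n m df dg h \<rho> a b S" "\<And>u. h' u = h u + r"
  shows "contracts n m df dg h' \<rho> a b S"
  using assms by (simp add: contracts_def)

primrec alg_iter :: "(fseq \<Rightarrow> algorithm) \<Rightarrow> nat \<Rightarrow> fseq \<Rightarrow> algorithm" where
  "alg_iter S 0 x = Output x"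
| "alg_iter S (Suc j) x = alg_bind (S x) (alg_iter S j)"

lemma contracts_iter:
  assumes S: "contracts n m df dg h \<rho> a b S" and \<rho>: "0 \<le> \<rho>"
  shows "contracts n m df dg h (\<rho> ^ j) (j * a) (j * b) (alg_iter S j)"
proof (induction j)
  case 0
  show ?case by (simp add: contracts_def)
next
  case (Suc j)
  show ?case
  proof (rule contractsI)
    fix w assume w: "w \<in> Rn n"
    note wS = contractsD(1)[OF S w]
    show "bounded_run n m df dg (alg_iter S (Suc j) w) (Suc j * a) (Suc j * b)"
      using bounded_run_bind[OF wS contractsD(1)[OF Suc]] by simp
    fix v assume v: "v \<in> Rn n" "\<And>u. u \<in> Rn n \<Longrightarrow> h v \<le> h u"
    have "expect df dg (alg_iter S (Suc j) w) (\<lambda>u. h u - h v) =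
        expect df dg (S w) (\<lambda>x. expect df dg (alg_iter S j x) (\<lambda>u. h u - h v))"
      by (simp add: expect_bind)
    also have "\<dots> \<le> expect df dg (S w) (\<lambda>x. 0 + \<rho> ^ j * (h x - h v))"
      using contractsD(2)[OF Suc _ v(1)] v(2) by (intro expect_mono[OF wS]) auto
    also have "\<dots> = \<rho> ^ j * expect df dg (S w) (\<lambda>x. h x - h v)"
      by (subst expect_affine[OF wS]) simp
    also have "\<dots> \<le> \<rho> ^ j * (\<rho> * (h w - h v))"
      using contractsD(2)[OF S w v(1)] v(2) \<rho> by (intro mult_left_mono) auto
    finally show "expect df dg (alg_iter S (Suc j) w) (\<lambda>u. h u - h v) \<le> \<rho> ^ Suc j * (h w - h v)"
      by (simp add: mult_ac)
  qed
qed

primrec sum_grads :: "nat \<Rightarrow> fseq \<Rightarrow> fseq \<Rightarrow> (fseq \<Rightarrow> algorithm) \<Rightarrow> algorithm" where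
  "sum_grads 0 x acc K = K acc"
| "sum_grads (Suc k) x acc K = Grad_g (Suc k) x (\<lambda>d. sum_grads k x (acc + d) K)"

lemma expect_sum_grads:
  "expect df dg (sum_grads k x acc K) W = expect df dg (K (acc + (\<Sum>i=1..k. dg i x))) W"
  by (induction k arbitrary: acc) (simp_all add: ac_simps)

lemma bounded_run_sum_grads:
  assumes "bounded_run n m df dg (K (acc + (\<Sum>i=1..k. dg i x))) a b" "x \<in> Rn n" "k \<le> m"
  shows "bounded_run n m df dg (sum_grads k x acc K) a (k + b)"
  using assms(1,3)
proof (induction k arbitrary: acc)
  case (Suc k)
  have "bounded_run n m df dg (sum_grads k x (acc + dg (Suc k) x) K) a (k + b)"
    by (rule Suc.IH) (use Suc.prems in \<open>simp_all add: ac_simps\<close>)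
  then show ?case using Suc.prems assms(2) by simp
qed simp

section \<open>Stochastic variance reduction\<close>

lemma norm_sq_add_le:
  fixes a b :: "'a::real_inner"
  shows "(norm (a - b))\<^sup>2 \<le> 2 * (norm a)\<^sup>2 + 2 * (norm b)\<^sup>2"
proof -
  have "(norm (a - b))\<^sup>2 + (norm (a + b))\<^sup>2 = 2 * (norm a)\<^sup>2 + 2 * (norm b)\<^sup>2"
    by (simp add: power2_norm_eq_inner inner_add_left inner_add_right inner_diff_left
        inner_diff_right inner_commute)
  then show ?thesis using zero_le_power2[of "norm (a + b)"] by linarith
qed

lemma sum_norm_sq_centered_le:
  fixes q :: "'b \<Rightarrow> 'a::real_inner"
  assumes "sum q A = real (card A) *\<^sub>R c"
  shows "(\<Sum>k\<in>A. (norm (q k - c))\<^sup>2) \<le> (\<Sum>k\<in>A. (norm (q k))\<^sup>2)"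
proof -
  have "(norm (q k - c))\<^sup>2 = (norm (q k))\<^sup>2 - 2 * inner (q k) c + (norm c)\<^sup>2" for k
    by (simp add: power2_norm_eq_inner inner_diff_left inner_diff_right inner_commute)
  then have "(\<Sum>k\<in>A. (norm (q k - c))\<^sup>2) =
      (\<Sum>k\<in>A. (norm (q k))\<^sup>2) - 2 * inner (sum q A) c + real (card A) * (norm c)\<^sup>2"
    by (simp add: sum.distrib sum_subtractf inner_sum_left sum_distrib_left)
  also have "\<dots> = (\<Sum>k\<in>A. (norm (q k))\<^sup>2) - real (card A) * (norm c)\<^sup>2"
    by (simp add: assms power2_norm_eq_inner)
  finally show ?thesis by simp
qed

text \<open>
  One variance-reduced step, averaged over the sampled index. The mean of the search directions
  is the full gradient at \<open>x\<close>. Their second moment is controlled by splitting the direction into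
  \<open>H k x - H k xs\<close> and the centred \<open>H k w - H k xs\<close>; by cocoercivity both second moments are at
  most a multiple of the optimality gaps at \<open>x\<close> and at the reference point \<open>w\<close>.
\<close>

lemma svrg_step:
  fixes h :: "nat \<Rightarrow> 'a::real_inner \<Rightarrow> real"
  assumes V: "subspace V" and L: "0 < L"
    and h: "\<And>k. k \<in> {1..m} \<Longrightarrow> tangent_bounds V L (h k) (H k)"
    and \<eta>: "0 \<le> \<eta>"
    and pts: "x \<in> V" "w \<in> V" "xs \<in> V" and stat: "(\<Sum>k=1..m. H k xs) = 0"
    and v: "(\<Sum>k=1..m. H k w) = real m *\<^sub>R v"
  shows "(\<Sum>k=1..m. (norm (x - \<eta> *\<^sub>R (H k x - H k w + v) - xs))\<^sup>2)
    \<le> real m * (norm (x - xs))\<^sup>2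
      - 2 * \<eta> * (1 - 2 * L * \<eta>) * (\<Sum>k=1..m. h k x - h k xs)
      + 4 * L * \<eta>\<^sup>2 * (\<Sum>k=1..m. h k w - h k xs)"
proof -
  define e where "e k = H k x - H k w + v" for k
  have sum_e: "(\<Sum>k=1..m. e k) = (\<Sum>k=1..m. H k x)"
    by (simp add: e_def sum.distrib sum_subtractf sum_constant_scaleR v[unfolded One_nat_def])
  have dev: "(\<Sum>k=1..m. (norm (H k u - H k xs))\<^sup>2) \<le> 2 * L * (\<Sum>k=1..m. h k u - h k xs)"
    if "u \<in> V" for u
  proof -
    have "(\<Sum>k=1..m. (norm (H k u - H k xs))\<^sup>2)
        \<le> (\<Sum>k=1..m. 2 * L * (h k u - h k xs - inner (H k xs) (u - xs)))"
      by (intro sum_mono tangent_bounds_cocoercive[OF V h L that pts(3)])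
    also have "\<dots> = 2 * L * ((\<Sum>k=1..m. h k u - h k xs) - inner (\<Sum>k=1..m. H k xs) (u - xs))"
      by (simp add: sum_subtractf inner_sum_left flip: sum_distrib_left)
    finally show ?thesis by (simp only: stat inner_zero_left diff_zero)
  qed
  have "(\<Sum>k=1..m. (norm (e k))\<^sup>2)
      \<le> (\<Sum>k=1..m. 2 * (norm (H k x - H k xs))\<^sup>2 + 2 * (norm (H k w - H k xs - v))\<^sup>2)"
    by (intro sum_mono order_trans[OF _ norm_sq_add_le]) (simp add: e_def algebra_simps)
  also have "\<dots> = 2 * (\<Sum>k=1..m. (norm (H k x - H k xs))\<^sup>2) + 2 * (\<Sum>k=1..m. (norm (H k w - H k xs - v))\<^sup>2)"
    by (simp add: sum.distrib sum_distrib_left)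
  also have "(\<Sum>k=1..m. (norm (H k w - H k xs - v))\<^sup>2) \<le> (\<Sum>k=1..m. (norm (H k w - H k xs))\<^sup>2)"
    by (rule sum_norm_sq_centered_le)
      (simp add: sum_subtractf stat[unfolded One_nat_def] v[unfolded One_nat_def])
  finally have var: "(\<Sum>k=1..m. (norm (e k))\<^sup>2)
      \<le> 4 * L * ((\<Sum>k=1..m. h k x - h k xs) + (\<Sum>k=1..m. h k w - h k xs))"
    using dev[OF pts(1)] dev[OF pts(2)] by (simp add: algebra_simps)
  have "(\<Sum>k=1..m. h k x - h k xs) \<le> (\<Sum>k=1..m. inner (H k x) (x - xs))"
  proof (rule sum_mono)
    fix k assume "k \<in> {1..m}"
    from tangent_boundsD(2)[OF h[OF this] pts(1,3)]
    show "h k x - h k xs \<le> inner (H k x) (x - xs)" by (simp add: inner_diff_right)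
  qed
  then have lin: "(\<Sum>k=1..m. h k x - h k xs) \<le> inner (\<Sum>k=1..m. e k) (x - xs)"
    by (simp only: sum_e inner_sum_left)
  have "(norm (x - \<eta> *\<^sub>R e k - xs))\<^sup>2
      = (norm (x - xs))\<^sup>2 - 2 * \<eta> * inner (e k) (x - xs) + \<eta>\<^sup>2 * (norm (e k))\<^sup>2" for k
    using norm_sq_add_scaled[of "x - xs" "- \<eta>" "e k"] by (simp add: algebra_simps inner_commute)
  then have "(\<Sum>k=1..m. (norm (x - \<eta> *\<^sub>R e k - xs))\<^sup>2) =
      real m * (norm (x - xs))\<^sup>2 - 2 * \<eta> * inner (\<Sum>k=1..m. e k) (x - xs)
      + \<eta>\<^sup>2 * (\<Sum>k=1..m. (norm (e k))\<^sup>2)"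
    by (simp add: sum.distrib sum_subtractf inner_sum_left sum_distrib_left)
  also have "\<dots> \<le> real m * (norm (x - xs))\<^sup>2 - 2 * \<eta> * (\<Sum>k=1..m. h k x - h k xs)
      + \<eta>\<^sup>2 * (4 * L * ((\<Sum>k=1..m. h k x - h k xs) + (\<Sum>k=1..m. h k w - h k xs)))"
    using lin var \<eta> by (intro add_mono diff_mono mult_left_mono order_refl) auto
  also have "\<dots> = real m * (norm (x - xs))\<^sup>2
      - 2 * \<eta> * (1 - 2 * L * \<eta>) * (\<Sum>k=1..m. h k x - h k xs)
      + 4 * L * \<eta>\<^sup>2 * (\<Sum>k=1..m. h k w - h k xs)"
    by (simp add: algebra_simps power2_eq_square)
  finally show ?thesis by (simp add: e_def)
qed

text \<open>
  All subproblems of the method, up to additive constants, have this form: each proximal term only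
  changes the linear and the quadratic coefficient.
\<close>

definition reg_avg :: "nat \<Rightarrow> (nat \<Rightarrow> fseq \<Rightarrow> real) \<Rightarrow> fseq \<Rightarrow> real \<Rightarrow> fseq \<Rightarrow> real" where
  "reg_avg m g c s x = 1 / real m * (\<Sum>k=1..m. g k x) + (inner c x + s / 2 * (norm x)\<^sup>2)"

text \<open>
  Here \<open>w\<close> is the reference point and \<open>v\<close> the full gradient of the regularized average there. The
  regularizer counts as part of every summand, whence the term \<open>s *\<^sub>R (x - w)\<close>.
\<close>

primrec svrg_steps ::
    "nat \<Rightarrow> real \<Rightarrow> real \<Rightarrow> fseq \<Rightarrow> fseq \<Rightarrow> nat \<Rightarrow> fseq \<Rightarrow> algorithm" where
  "svrg_steps m \<eta> s w v 0 x = Output x"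
| "svrg_steps m \<eta> s w v (Suc t) x = Draw (pmf_of_set {1..m}) (\<lambda>k. Grad_g k x (\<lambda>a. Grad_g k w (\<lambda>b.
      svrg_steps m \<eta> s w v t (x - \<eta> *\<^sub>R (a - b + s *\<^sub>R (x - w) + v)))))"

text \<open>
  The epoch returns an iterate of uniformly random index. Drawing the index beforehand saves
  the steps after it, and makes the expected gap of the output the average of the expected gaps of
  the iterates.
\<close>

definition svrg_epoch :: "nat \<Rightarrow> real \<Rightarrow> fseq \<Rightarrow> real \<Rightarrow> nat \<Rightarrow> fseq \<Rightarrow> algorithm" where
  "svrg_epoch m \<eta> c s T w = sum_grads m w 0 (\<lambda>\<sigma>. Draw (pmf_of_set {..<T}) (\<lambda>t.
      svrg_steps m \<eta> s w ((1 / real m) *\<^sub>R \<sigma> + (c + s *\<^sub>R w)) t w))"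

lemma bounded_run_svrg_steps:
  assumes dg: "\<And>k x. k \<in> {1..m} \<Longrightarrow> x \<in> Rn n \<Longrightarrow> dg k x \<in> Rn n"
    and "1 \<le> m" "w \<in> Rn n" "v \<in> Rn n" "x \<in> Rn n"
  shows "bounded_run n m df dg (svrg_steps m \<eta> s w v t x) 0 (2 * t)"
  using assms(5)
proof (induction t arbitrary: x)
  case (Suc t)
  have "bounded_run n m df dg
      (svrg_steps m \<eta> s w v t (x - \<eta> *\<^sub>R (dg k x - dg k w + s *\<^sub>R (x - w) + v))) 0 (2 * t)"
    if "k \<in> {1..m}" for k
    using assms(3,4) Suc.prems dg[OF that]
    by (intro Suc.IH subspace_diff[OF subspace_Rn] subspace_add[OF subspace_Rn]
        subspace_scale[OF subspace_Rn]) auto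
  then show ?case using Suc.prems assms(2,3) by simp
qed simp

lemma expect_Draw_pmf_of_set:
  assumes "finite A" "A \<noteq> {}"
  shows "expect df dg (Draw (pmf_of_set A) cont) W = (\<Sum>i\<in>A. expect df dg (cont i) W) / card A"
  using assms by (simp add: integral_pmf_of_set)

text \<open>
  Unrolling \<open>svrg_step\<close> from the first step: after one random step the induction hypothesis
  applies to each possible successor, and the decrease of the squared distance to \<open>xs\<close> pays for the gap
  at \<open>x\<close>. With \<open>\<eta> = 1 / (10 L)\<close> the coefficients in \<open>svrg_step\<close> are \<open>4 / (25 L)\<close> for the gap at
  \<open>x\<close> and \<open>1 / (25 L)\<close> for the gap at \<open>w\<close>.
\<close>

lemma svrg_steps_total_gap:
  assumes g: "\<And>k. k \<in> {1..m} \<Longrightarrow> tangent_bounds (Rn n) Lg (g k) (dg k)" and "0 < Lg" "0 \<le> s"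
    and m: "1 \<le> m" and c: "c \<in> Rn n"
    and L: "L = Lg + s" and \<eta>: "\<eta> = 1 / (10 * L)"
    and xs: "xs \<in> Rn n" "(1 / real m) *\<^sub>R (\<Sum>k=1..m. dg k xs) + (c + s *\<^sub>R xs) = 0"
    and w: "w \<in> Rn n" and v: "v = (1 / real m) *\<^sub>R (\<Sum>k=1..m. dg k w) + (c + s *\<^sub>R w)"
    and x: "x \<in> Rn n"
  defines "W \<equiv> \<lambda>u. reg_avg m g c s u - reg_avg m g c s xs"
  shows "4 * (\<Sum>t<T. expect df dg (svrg_steps m \<eta> s w v t x) W)
    \<le> 25 * L * (norm (x - xs))\<^sup>2 + real T * W w"
  using x
proof (induction T arbitrary: x)
  case 0
  then show ?case using assms(2,3) by (simp add: L)
next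
  case (Suc T)
  define h where "h k x = g k x + (inner c x + s / 2 * (norm x)\<^sup>2)" for k x
  define H where "H k x = dg k x + (c + s *\<^sub>R x)" for k x
  have m0: "real m > 0" and L0: "L > 0" using m assms(2,3) by (auto simp: L)
  have h: "tangent_bounds (Rn n) L (h k) (H k)" if "k \<in> {1..m}" for k
    unfolding h_def H_def L
    by (intro tangent_bounds_add subspace_Rn g[OF that] tangent_bounds_quadratic c assms(3))
  have sumH: "(\<Sum>k=1..m. H k u) = real m *\<^sub>R ((1 / real m) *\<^sub>R (\<Sum>k=1..m. dg k u) + (c + s *\<^sub>R u))" for u
    using m0 by (simp add: H_def sum.distrib sum_constant_scaleR scaleR_add_right)
  have sumh: "(\<Sum>k=1..m. h k u - h k xs) = real m * W u" for u
  proof -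
    have "(\<Sum>k=1..m. h k y) = real m * reg_avg m g c s y" for y
      using m0 by (simp add: h_def reg_avg_def sum.distrib distrib_left)
    then show ?thesis by (simp only: sum_subtractf W_def right_diff_distrib)
  qed
  define x' where "x' k = x - \<eta> *\<^sub>R (dg k x - dg k w + s *\<^sub>R (x - w) + v)" for k
  have x'_eq: "x' k = x - \<eta> *\<^sub>R (H k x - H k w + v)" for k
    by (simp add: x'_def H_def algebra_simps)
  have v': "v \<in> Rn n"
    unfolding v using c w tangent_boundsD(1)[OF g]
    by (intro subspace_add[OF subspace_Rn] subspace_scale[OF subspace_Rn] subspace_sum[OF subspace_Rn]) auto
  have x'_in: "x' k \<in> Rn n" if "k \<in> {1..m}" for k
    unfolding x'_def using Suc.prems w v' tangent_boundsD(1)[OF g[OF that]]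
    by (intro subspace_diff[OF subspace_Rn] subspace_add[OF subspace_Rn] subspace_scale[OF subspace_Rn]) auto
  have "(\<Sum>k=1..m. (norm (x' k - xs))\<^sup>2) \<le> real m * (norm (x - xs))\<^sup>2
      - 2 * \<eta> * (1 - 2 * L * \<eta>) * (real m * W x) + 4 * L * \<eta>\<^sup>2 * (real m * W w)"
    unfolding x'_eq sumh[symmetric]
  proof (rule svrg_step[OF subspace_Rn L0 h _ Suc.prems w xs(1)])
    show "0 \<le> \<eta>" using L0 by (simp add: \<eta>)
    show "(\<Sum>k=1..m. H k xs) = 0" by (simp only: sumH xs(2) scaleR_zero_right)
    show "(\<Sum>k=1..m. H k w) = real m *\<^sub>R v" by (simp only: sumH v)
  qed
  also have "\<dots> = real m * ((norm (x - xs))\<^sup>2 - 4 / (25 * L) * W x + 1 / (25 * L) * W w)"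
    using L0 by (simp add: \<eta> power2_eq_square field_simps)
  finally have "(\<Sum>k=1..m. (norm (x' k - xs))\<^sup>2) / real m
      \<le> (norm (x - xs))\<^sup>2 - 4 / (25 * L) * W x + 1 / (25 * L) * W w"
    using m0 by (simp add: pos_divide_le_eq mult.commute)
  then have step: "25 * L * ((\<Sum>k=1..m. (norm (x' k - xs))\<^sup>2) / real m)
      \<le> 25 * L * ((norm (x - xs))\<^sup>2 - 4 / (25 * L) * W x + 1 / (25 * L) * W w)"
    using L0 by (intro mult_left_mono) auto
  have "25 * L * ((norm (x - xs))\<^sup>2 - 4 / (25 * L) * W x + 1 / (25 * L) * W w)
      = 25 * L * (norm (x - xs))\<^sup>2 - 4 * W x + W w"
    using L0 by (simp add: field_simps)
  note step = step[unfolded this]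
  have "4 * (\<Sum>t<T. expect df dg (svrg_steps m \<eta> s w v (Suc t) x) W)
      = (\<Sum>k=1..m. 4 * (\<Sum>t<T. expect df dg (svrg_steps m \<eta> s w v t (x' k)) W)) / real m"
  proof -
    have "expect df dg (svrg_steps m \<eta> s w v (Suc t) x) W
        = (\<Sum>k=1..m. expect df dg (svrg_steps m \<eta> s w v t (x' k)) W) / real m" for t
      using m unfolding svrg_steps.simps
      by (subst expect_Draw_pmf_of_set) (auto simp: x'_def)
    then have "(\<Sum>t<T. expect df dg (svrg_steps m \<eta> s w v (Suc t) x) W)
        = (\<Sum>k=1..m. (\<Sum>t<T. expect df dg (svrg_steps m \<eta> s w v t (x' k)) W)) / real m"
      by (simp only: sum_divide_distrib[symmetric] sum.swap[of _ "{1..m}"])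
    then show ?thesis by (simp only: sum_distrib_left[symmetric] times_divide_eq_right)
  qed
  also have "\<dots> \<le> (\<Sum>k=1..m. 25 * L * (norm (x' k - xs))\<^sup>2 + real T * W w) / real m"
    using m0 by (intro divide_right_mono sum_mono Suc.IH x'_in) auto
  also have "\<dots> = 25 * L * ((\<Sum>k=1..m. (norm (x' k - xs))\<^sup>2) / real m) + real T * W w"
    using m0 by (simp add: sum.distrib sum_distrib_left[symmetric] add_divide_distrib)
  finally have "4 * (\<Sum>t<T. expect df dg (svrg_steps m \<eta> s w v (Suc t) x) W)
      \<le> 25 * L * (norm (x - xs))\<^sup>2 - 4 * W x + W w + real T * W w"
    using step by linarith
  moreover have "(\<Sum>t<Suc T. expect df dg (svrg_steps m \<eta> s w v t x) W)
      = W x + (\<Sum>t<T. expect df dg (svrg_steps m \<eta> s w v (Suc t) x) W)"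
    by (subst sum.lessThan_Suc_shift) simp
  ultimately show ?case by (simp add: algebra_simps)
qed

lemma reg_avg_tangent_bounds:
  assumes "\<And>k. k \<in> {1..m} \<Longrightarrow> tangent_bounds (Rn n) Lg (g k) (dg k)"
    and "1 \<le> m" "c \<in> Rn n" "0 \<le> s"
  shows "tangent_bounds (Rn n) (Lg + s) (reg_avg m g c s)
    (\<lambda>x. (1 / real m) *\<^sub>R (\<Sum>k=1..m. dg k x) + (c + s *\<^sub>R x))"
  unfolding reg_avg_def
  by (intro tangent_bounds_add tangent_bounds_average tangent_bounds_quadratic subspace_Rn assms)

lemma reg_avg_strongly_convex:
  assumes "\<And>k. k \<in> {1..m} \<Longrightarrow> convex_on (Rn n) (g k)"
  shows "strongly_convex_on (Rn n) s (reg_avg m g c s)"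
proof -
  have "convex (Rn n)" by (rule subspace_imp_convex[OF subspace_Rn])
  have "convex_on (Rn n) (\<lambda>x. \<Sum>k\<in>A. g k x)" if "finite A" "A \<subseteq> {1..m}" for A
    using that(1,2)
  proof (induction A rule: finite_induct)
    case empty
    then show ?case using \<open>convex (Rn n)\<close> by (simp add: convex_on_def)
  next
    case (insert k A)
    then show ?case using assms by (auto intro!: convex_on_add)
  qed
  then have "convex_on (Rn n) (\<lambda>x. \<Sum>k=1..m. g k x)" by simp
  then have "convex_on (Rn n) (\<lambda>x. 1 / real m * (\<Sum>k=1..m. g k x))"
    by (intro convex_on_cmul) auto
  from strongly_convex_on_quadratic[OF this] show ?thesis unfolding reg_avg_def .
qed

text \<open>
  A quarter of the gap comes from the variance caused by the reference point, and another quarter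
  from the initial squared distance, which strong convexity bounds by the gap and which \<open>T\<close> steps
  spread out; this is where \<open>T\<close> must be at least \<open>50\<close> times the condition number.
\<close>

lemma svrg_epoch_contracts:
  assumes g: "\<And>k. k \<in> {1..m} \<Longrightarrow> tangent_bounds (Rn n) Lg (g k) (dg k)"
    and cvx: "\<And>k. k \<in> {1..m} \<Longrightarrow> convex_on (Rn n) (g k)"
    and Lg: "0 < Lg" and s: "0 < s" and m: "1 \<le> m" and c: "c \<in> Rn n"
    and T: "50 * (Lg + s) \<le> s * real T"
  shows "contracts n m df dg (reg_avg m g c s) (1 / 2) 0 (m + 2 * T)
    (svrg_epoch m (1 / (10 * (Lg + s))) c s T)"
proof (rule contractsI)
  define L where "L = Lg + s"
  define G where "G x = (1 / real m) *\<^sub>R (\<Sum>k=1..m. dg k x) + (c + s *\<^sub>R x)" for x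
  have L0: "0 < L" using Lg s by (simp add: L_def)
  have tb: "tangent_bounds (Rn n) L (reg_avg m g c s) G"
    unfolding L_def G_def using s by (intro reg_avg_tangent_bounds g m c) auto
  have sc: "strongly_convex_on (Rn n) s (reg_avg m g c s)" by (rule reg_avg_strongly_convex[OF cvx])
  have "0 < s * real T" using T Lg s by (auto intro: less_le_trans[of 0 "50 * (Lg + s)"])
  then have T0: "0 < T" using s by (simp add: zero_less_mult_iff)
  fix w assume w: "w \<in> Rn n"
  have Gw: "G w \<in> Rn n" by (rule tangent_boundsD(1)[OF tb w])
  have dg: "dg k x \<in> Rn n" if "k \<in> {1..m}" "x \<in> Rn n" for k x
    by (rule tangent_boundsD(1)[OF g[OF that(1)] that(2)])
  have "bounded_run n m df dg (Draw (pmf_of_set {..<T}) (\<lambda>t.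
      svrg_steps m (1 / (10 * L)) s w (G w) t w)) 0 (2 * T)"
  proof -
    have "bounded_run n m df dg (svrg_steps m (1 / (10 * L)) s w (G w) t w) 0 (2 * T)" if "t < T" for t
      by (rule bounded_run_mono[OF bounded_run_svrg_steps[OF dg m w Gw w]]) (use that in auto)
    moreover have "set_pmf (pmf_of_set {..<T}) = {..<T}" using T0 by (intro set_pmf_of_set) auto
    ultimately show ?thesis by simp
  qed
  then show "bounded_run n m df dg (svrg_epoch m (1 / (10 * (Lg + s))) c s T w) 0 (m + 2 * T)"
    unfolding svrg_epoch_def L_def[symmetric] by (intro bounded_run_sum_grads w) (auto simp: G_def)
  fix v assume v: "v \<in> Rn n" "\<And>u. u \<in> Rn n \<Longrightarrow> reg_avg m g c s v \<le> reg_avg m g c s u"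
  define W where "W u = reg_avg m g c s u - reg_avg m g c s v" for u
  have growth: "s / 2 * (norm (w - v))\<^sup>2 \<le> W w"
    using strongly_convex_on_growth[OF sc v w] by (simp add: W_def)
  \<comment> \<open>A gradient step from the minimizer would decrease the function unless the gradient vanishes.\<close>
  have Gv: "G v = 0"
  proof -
    have Gv: "G v \<in> Rn n" by (rule tangent_boundsD(1)[OF tb v(1)])
    define z where "z = v - (1 / L) *\<^sub>R G v"
    have z: "z \<in> Rn n"
      unfolding z_def by (intro subspace_diff[OF subspace_Rn] subspace_scale[OF subspace_Rn] v Gv)
    have "reg_avg m g c s v \<le> reg_avg m g c s z" by (rule v(2)[OF z])
    also have "\<dots> \<le> reg_avg m g c s v + inner (G v) (z - v) + L / 2 * (norm (z - v))\<^sup>2"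
      by (rule tangent_boundsD(3)[OF tb v(1) z])
    also have "\<dots> = reg_avg m g c s v - (norm (G v))\<^sup>2 / (2 * L)"
      using L0 by (simp add: z_def power_divide flip: power2_norm_eq_inner) (simp add: field_simps power2_eq_square)
    finally show ?thesis using L0 by (simp add: divide_le_0_iff)
  qed
  have "4 * (\<Sum>t<T. expect df dg (svrg_steps m (1 / (10 * L)) s w (G w) t w) W)
      \<le> 25 * L * (norm (w - v))\<^sup>2 + real T * W w"
    unfolding W_def
    by (rule svrg_steps_total_gap[OF g Lg _ m c L_def refl v(1) _ w _ w])
      (use s Gv in \<open>auto simp: G_def\<close>)
  moreover have "25 * L * (norm (w - v))\<^sup>2 \<le> real T * W w"
  proof -
    have "25 * L * (norm (w - v))\<^sup>2 \<le> (s * real T / 2) * (norm (w - v))\<^sup>2"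
      using T by (intro mult_right_mono) (auto simp: L_def)
    also have "\<dots> = real T * (s / 2 * (norm (w - v))\<^sup>2)" by simp
    also have "\<dots> \<le> real T * W w" using growth by (intro mult_left_mono) auto
    finally show ?thesis .
  qed
  ultimately have "(\<Sum>t<T. expect df dg (svrg_steps m (1 / (10 * L)) s w (G w) t w) W)
      \<le> 1 / 2 * W w * real T" by (simp add: mult.commute)
  then have "(\<Sum>t<T. expect df dg (svrg_steps m (1 / (10 * L)) s w (G w) t w) W) / real T
      \<le> 1 / 2 * W w" using T0 by (simp add: pos_divide_le_eq)
  moreover have "expect df dg (svrg_epoch m (1 / (10 * (Lg + s))) c s T w) W
      = (\<Sum>t<T. expect df dg (svrg_steps m (1 / (10 * L)) s w (G w) t w) W) / real T"
    unfolding svrg_epoch_def L_def[symmetric] expect_sum_grads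
    using T0 by (subst expect_Draw_pmf_of_set) (auto simp: G_def)
  ultimately show "expect df dg (svrg_epoch m (1 / (10 * (Lg + s))) c s T w)
      (\<lambda>u. reg_avg m g c s u - reg_avg m g c s v)
      \<le> 1 / 2 * (reg_avg m g c s w - reg_avg m g c s v)"
    by (simp add: W_def[abs_def])
qed

section \<open>Inexact accelerated proximal steps\<close>

text \<open>
  The function minimized by a proximal gradient step at \<open>y\<close> for the sum of a smooth \<open>\<phi>\<close> with gradient \<open>G\<close>
  and \<open>\<psi>\<close>, without the additive constant \<open>\<phi> y - G y \<bullet> y\<close>.
\<close>

definition prox_model ::
    "real \<Rightarrow> ('a::real_inner \<Rightarrow> 'a) \<Rightarrow> ('a \<Rightarrow> real) \<Rightarrow> 'a \<Rightarrow> 'a \<Rightarrow> real" where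
  "prox_model L G \<psi> y x = inner (G y) x + L / 2 * (norm (x - y))\<^sup>2 + \<psi> x"

lemma norm_sq_convex_combination:
  fixes a b :: "'a::real_inner"
  shows "(norm ((1 - t) *\<^sub>R a + t *\<^sub>R b))\<^sup>2
    = (1 - t) * (norm a)\<^sup>2 + t * (norm b)\<^sup>2 - t * (1 - t) * (norm (a - b))\<^sup>2"
  by (simp add: power2_norm_eq_inner inner_add_left inner_add_right inner_diff_left
      inner_diff_right inner_commute algebra_simps)

lemma norm_sq_add_young:
  fixes a b :: "'a::real_inner"
  assumes "0 < t"
  shows "(1 - t) * (norm (a + b))\<^sup>2 \<le> (norm a)\<^sup>2 + (1 / t - 1) * (norm b)\<^sup>2"
proof -
  have "t * (norm a)\<^sup>2 + (1 - t) * (norm b)\<^sup>2 - t * (1 - t) * (norm (a + b))\<^sup>2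
      = (norm (t *\<^sub>R a - (1 - t) *\<^sub>R b))\<^sup>2"
    unfolding power2_norm_eq_inner
    by (simp add: inner_add_left inner_add_right inner_diff_left inner_diff_right inner_commute)
      (simp add: algebra_simps)
  then have "t * ((1 - t) * (norm (a + b))\<^sup>2) \<le> t * (norm a)\<^sup>2 + (1 - t) * (norm b)\<^sup>2"
    using zero_le_power2[of "norm (t *\<^sub>R a - (1 - t) *\<^sub>R b)"] by linarith
  also have "\<dots> = t * ((norm a)\<^sup>2 + (1 / t - 1) * (norm b)\<^sup>2)"
    using assms by (simp add: field_simps)
  finally show ?thesis using assms by simp
qed

text \<open>
  The potential weighs the distance of \<open>z\<close> with \<open>\<mu> / 4 = L \<tau>\<^sup>2 / 2\<close>, the curvature of the
  proximal term after the change of scale by \<open>\<tau>\<close> in \<open>u - x' = \<tau> (xs - z')\<close> below.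
\<close>

definition accel_potential :: "real \<Rightarrow> ('a::real_inner \<Rightarrow> real) \<Rightarrow> 'a \<Rightarrow> 'a \<Rightarrow> 'a \<Rightarrow> real" where
  "accel_potential \<mu> \<Phi> xs x z = \<Phi> x - \<Phi> xs + \<mu> / 4 * (norm (z - xs))\<^sup>2"

definition accel_point :: "real \<Rightarrow> 'a::real_inner \<Rightarrow> 'a \<Rightarrow> 'a" where
  "accel_point \<tau> x z = x + (\<tau> * (1 - \<tau>)) *\<^sub>R (z - x)"

context
  fixes V :: "'a::real_inner set" and L \<mu> \<tau> :: real
    and \<phi> \<psi> \<Phi> :: "'a \<Rightarrow> real" and G :: "'a \<Rightarrow> 'a" and xs :: 'a
  assumes V: "subspace V" and \<phi>: "tangent_bounds V L \<phi> G"
    and \<Phi>: "\<And>x. \<Phi> x = \<phi> x + \<psi> x" and sc: "strongly_convex_on V \<mu> \<Phi>"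
    and scQ: "\<And>y. y \<in> V \<Longrightarrow> strongly_convex_on V L (prox_model L G \<psi> y)"
    and \<mu>: "0 < \<mu>" and \<tau>: "0 < \<tau>" "\<tau> \<le> 1 / 2" "L * \<tau>\<^sup>2 = \<mu> / 2"
    and xs: "xs \<in> V" "\<And>u. u \<in> V \<Longrightarrow> \<Phi> xs \<le> \<Phi> u"
begin

lemma accel_potential_nonneg: "x \<in> V \<Longrightarrow> 0 \<le> accel_potential \<mu> \<Phi> xs x z"
  using xs(2)[of x] \<mu> by (simp add: accel_potential_def)

lemma accel_point_in: "x \<in> V \<Longrightarrow> z \<in> V \<Longrightarrow> accel_point \<tau> x z \<in> V"
  unfolding accel_point_def by (intro subspace_add[OF V] subspace_scale[OF V] subspace_diff[OF V])

lemma prox_model_bounds: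
  assumes "u \<in> V" "y \<in> V"
  shows "\<Phi> u \<le> prox_model L G \<psi> y u + (\<phi> y - inner (G y) y)"
    and "prox_model L G \<psi> y u + (\<phi> y - inner (G y) y) \<le> \<Phi> u + L / 2 * (norm (u - y))\<^sup>2"
  using tangent_boundsD(2,3)[OF \<phi> assms(2,1)]
  by (auto simp: \<Phi> prox_model_def inner_diff_right)

text \<open>
  The previous iterate is a good enough starting point for the proximal subproblem: its gap there is
  bounded by the potential. Therefore a fixed relative accuracy of the subproblem solver suffices, and
  errors need no absolute bound.
\<close>

lemma accel_warm_start:
  assumes x: "x \<in> V" and z: "z \<in> V" and v: "v \<in> V"
  shows "prox_model L G \<psi> (accel_point \<tau> x z) x - prox_model L G \<psi> (accel_point \<tau> x z) v
    \<le> 2 * accel_potential \<mu> \<Phi> xs x z"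
proof -
  let ?y = "accel_point \<tau> x z"
  have y: "?y \<in> V" by (rule accel_point_in[OF x z])
  have L: "0 < L" using \<tau> \<mu> by (metis half_gt_zero zero_less_mult_pos2 zero_less_power)
  have "prox_model L G \<psi> ?y x - prox_model L G \<psi> ?y v \<le> \<Phi> x - \<Phi> xs + L / 2 * (norm (x - ?y))\<^sup>2"
    using prox_model_bounds[OF x y] prox_model_bounds[OF v y] xs(2)[OF v] by linarith
  moreover have "L / 2 * (norm (x - ?y))\<^sup>2 \<le> \<mu> / 2 * ((norm (z - xs))\<^sup>2 + (norm (x - xs))\<^sup>2)"
  proof -
    have "(norm (x - ?y))\<^sup>2 = (\<tau> * (1 - \<tau>))\<^sup>2 * (norm (z - x))\<^sup>2"
      by (simp add: accel_point_def power_mult_distrib)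
    also have "\<dots> \<le> \<tau>\<^sup>2 * (2 * (norm (z - xs))\<^sup>2 + 2 * (norm (x - xs))\<^sup>2)"
    proof (rule mult_mono)
      show "(\<tau> * (1 - \<tau>))\<^sup>2 \<le> \<tau>\<^sup>2"
        using \<tau> by (intro power_mono) (auto simp: mult_le_cancel_left1)
      show "(norm (z - x))\<^sup>2 \<le> 2 * (norm (z - xs))\<^sup>2 + 2 * (norm (x - xs))\<^sup>2"
        using norm_sq_add_le[of "z - xs" "x - xs"] by simp
    qed auto
    finally have "L / 2 * (norm (x - ?y))\<^sup>2
        \<le> L / 2 * (\<tau>\<^sup>2 * (2 * (norm (z - xs))\<^sup>2 + 2 * (norm (x - xs))\<^sup>2))"
      using L by (intro mult_left_mono) auto
    also have "\<dots> = (L * \<tau>\<^sup>2) * ((norm (z - xs))\<^sup>2 + (norm (x - xs))\<^sup>2)"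
      by (simp add: algebra_simps)
    finally show ?thesis by (simp add: \<tau>(3))
  qed
  moreover have "\<mu> / 2 * (norm (x - xs))\<^sup>2 \<le> \<Phi> x - \<Phi> xs"
    using strongly_convex_on_growth[OF sc xs x] by simp
  ultimately show ?thesis by (simp add: accel_potential_def distrib_left)
qed

text \<open>
  The exact minimizer \<open>v\<close> of the model is compared with \<open>u = (1 - \<tau>) x + \<tau> xs\<close>. Strong
  convexity of the model yields \<open>- L / 2 \<parallel>u - v\<parallel>\<^sup>2\<close>; replacing \<open>v\<close> by the computed point
  \<open>x'\<close> costs a factor \<open>1 - \<tau> / 2\<close> and a multiple of the error, and this factor uses
  up half of the contraction by \<open>1 - \<tau>\<close>. Only the sum \<open>\<Phi>\<close> is strongly convex with modulus \<open>\<mu>\<close>. Its strong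
  convexity is applied between \<open>x\<close> and \<open>xs\<close>, and absorbs the part of \<open>x\<close> that \<open>accel_point\<close>
  mixes into \<open>z\<close>.
\<close>

lemma accel_step:
  assumes x: "x \<in> V" and z: "z \<in> V" and x': "x' \<in> V" and v: "v \<in> V"
    and min: "\<And>u. u \<in> V \<Longrightarrow> prox_model L G \<psi> (accel_point \<tau> x z) v \<le> prox_model L G \<psi> (accel_point \<tau> x z) u"
  shows "accel_potential \<mu> \<Phi> xs x' (x + (1 / \<tau>) *\<^sub>R (x' - x)) \<le> (1 - \<tau> / 2) * accel_potential \<mu> \<Phi> xs x z
    + 4 / \<tau> * (prox_model L G \<psi> (accel_point \<tau> x z) x' - prox_model L G \<psi> (accel_point \<tau> x z) v)"
proof -
  define y where "y = accel_point \<tau> x z"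
  let ?Q = "prox_model L G \<psi> y"
  define \<delta> where "\<delta> = ?Q x' - ?Q v"
  define u where "u = (1 - \<tau>) *\<^sub>R x + \<tau> *\<^sub>R xs"
  define z' where "z' = x + (1 / \<tau>) *\<^sub>R (x' - x)"
  define E where "E = accel_potential \<mu> \<Phi> xs x z"
  have y: "y \<in> V" unfolding y_def by (rule accel_point_in[OF x z])
  have u: "u \<in> V" unfolding u_def by (intro subspace_add[OF V] subspace_scale[OF V] x xs)
  have L: "0 < L" using \<tau> \<mu> by (metis half_gt_zero zero_less_mult_pos2 zero_less_power)
  have growth: "?Q v + L / 2 * (norm (q - v))\<^sup>2 \<le> ?Q q" if "q \<in> V" for q
    by (rule strongly_convex_on_growth[OF scQ[OF y] v _ that]) (use min in \<open>simp add: y_def\<close>)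
  have \<delta>0: "L / 2 * (norm (v - x'))\<^sup>2 \<le> \<delta>"
    using growth[OF x'] by (simp add: \<delta>_def norm_minus_commute)
  \<comment> \<open>Young's inequality with parameter \<open>\<tau> / 2\<close> moves from the exact minimizer to the computed point.\<close>
  have "L / 2 * ((1 - \<tau> / 2) * (norm ((u - v) + (v - x')))\<^sup>2)
      \<le> L / 2 * ((norm (u - v))\<^sup>2 + (1 / (\<tau> / 2) - 1) * (norm (v - x'))\<^sup>2)"
    using L \<tau> by (intro mult_left_mono norm_sq_add_young) auto
  also have "\<dots> = L / 2 * (norm (u - v))\<^sup>2 + (2 / \<tau> - 1) * (L / 2 * (norm (v - x'))\<^sup>2)"
    by (simp add: distrib_left)
  also have "\<dots> \<le> L / 2 * (norm (u - v))\<^sup>2 + (2 / \<tau> - 1) * \<delta>"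
    using \<tau> by (intro add_left_mono mult_left_mono[OF \<delta>0]) (simp add: field_simps)
  finally have young: "(1 - \<tau> / 2) * (L / 2 * (norm (u - x'))\<^sup>2)
      \<le> L / 2 * (norm (u - v))\<^sup>2 + (2 / \<tau> - 1) * \<delta>"
    by (simp add: mult_ac)
  have "u - x' = \<tau> *\<^sub>R (xs - z')" using \<tau> by (simp add: u_def z'_def algebra_simps)
  then have "L / 2 * (norm (u - x'))\<^sup>2 = (L * \<tau>\<^sup>2) / 2 * (norm (xs - z'))\<^sup>2"
    using \<tau> by (simp add: power_mult_distrib)
  then have ux': "L / 2 * (norm (u - x'))\<^sup>2 = \<mu> / 4 * (norm (z' - xs))\<^sup>2"
    by (simp add: \<tau>(3) norm_minus_commute)
  \<comment> \<open>The choice of \<open>accel_point\<close> is made for this identity.\<close>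
  have "u - y = \<tau> *\<^sub>R ((1 - \<tau>) *\<^sub>R (xs - z) + \<tau> *\<^sub>R (xs - x))"
    by (simp add: u_def y_def accel_point_def algebra_simps)
  then have "L / 2 * (norm (u - y))\<^sup>2
      = (L * \<tau>\<^sup>2) / 2 * (norm ((1 - \<tau>) *\<^sub>R (xs - z) + \<tau> *\<^sub>R (xs - x)))\<^sup>2"
    using \<tau> by (simp add: power_mult_distrib)
  also have "\<dots> \<le> \<mu> / 4 * ((1 - \<tau>) * (norm (z - xs))\<^sup>2 + \<tau> * (norm (x - xs))\<^sup>2)"
    using \<mu> \<tau> by (simp add: \<tau>(3) norm_sq_convex_combination norm_minus_commute)
  finally have uy: "L / 2 * (norm (u - y))\<^sup>2
      \<le> \<mu> / 4 * ((1 - \<tau>) * (norm (z - xs))\<^sup>2 + \<tau> * (norm (x - xs))\<^sup>2)" .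
  have "\<Phi> u \<le> (1 - \<tau>) * \<Phi> x + \<tau> * \<Phi> xs - \<mu> / 2 * (1 - \<tau>) * \<tau> * (norm (x - xs))\<^sup>2"
    using sc x xs \<tau> unfolding strongly_convex_on_def u_def by simp
  moreover have "\<mu> / 4 * \<tau> * (norm (x - xs))\<^sup>2 \<le> \<mu> / 2 * (1 - \<tau>) * \<tau> * (norm (x - xs))\<^sup>2"
  proof (rule mult_right_mono)
    have "\<mu> / 2 * \<tau> * (1 / 2) \<le> \<mu> / 2 * \<tau> * (1 - \<tau>)" using \<mu> \<tau> by (intro mult_left_mono) auto
    then show "\<mu> / 4 * \<tau> \<le> \<mu> / 2 * (1 - \<tau>) * \<tau>" by (simp add: mult_ac)
  qed simp
  moreover have "(1 - \<tau>) * E = (1 - \<tau>) * \<Phi> x + \<tau> * \<Phi> xs - \<Phi> xs + \<mu> / 4 * ((1 - \<tau>) * (norm (z - xs))\<^sup>2)"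
    by (simp add: E_def accel_potential_def field_simps)
  ultimately have \<Phi>u: "\<Phi> u + L / 2 * (norm (u - y))\<^sup>2 - \<Phi> xs \<le> (1 - \<tau>) * E"
    using uy[unfolded distrib_left, folded mult.assoc] by (simp only: mult.assoc)
  have "\<Phi> x' + (1 - \<tau> / 2) * (\<mu> / 4 * (norm (z' - xs))\<^sup>2)
      \<le> \<Phi> u + L / 2 * (norm (u - y))\<^sup>2 + 2 / \<tau> * \<delta>"
    using prox_model_bounds(1)[OF x' y] prox_model_bounds(2)[OF u y] growth[OF u] young
    unfolding ux' by (simp add: \<delta>_def algebra_simps)
  then have main: "\<Phi> x' - \<Phi> xs + (1 - \<tau> / 2) * (\<mu> / 4 * (norm (z' - xs))\<^sup>2) \<le> (1 - \<tau>) * E + 2 / \<tau> * \<delta>"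
    using \<Phi>u by linarith
  have "(1 - \<tau> / 2) * (\<Phi> x' - \<Phi> xs) \<le> 1 * (\<Phi> x' - \<Phi> xs)"
    using \<tau> xs(2)[OF x'] by (intro mult_right_mono) auto
  then have "(1 - \<tau> / 2) * accel_potential \<mu> \<Phi> xs x' z' \<le> (1 - \<tau>) * E + 2 / \<tau> * \<delta>"
    using main by (simp add: accel_potential_def distrib_left)
  also have "\<dots> \<le> (1 - \<tau> / 2) * ((1 - \<tau> / 2) * E + 4 / \<tau> * \<delta>)"
  proof -
    have "0 \<le> \<tau>\<^sup>2 / 4 * E" using accel_potential_nonneg[OF x] by (simp add: E_def)
    moreover have "0 \<le> \<delta>" using \<delta>0 L by (auto intro: order_trans[of 0 "L / 2 * (norm (v - x'))\<^sup>2"])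
    then have "0 \<le> (2 / \<tau> - 2) * \<delta>" using \<tau> by (intro mult_nonneg_nonneg) (auto simp: field_simps)
    moreover have "(1 - \<tau> / 2) * ((1 - \<tau> / 2) * E + 4 / \<tau> * \<delta>)
        = (1 - \<tau>) * E + 2 / \<tau> * \<delta> + \<tau>\<^sup>2 / 4 * E + (2 / \<tau> - 2) * \<delta>"
      using \<tau> by (simp add: field_simps power2_eq_square)
    ultimately show ?thesis by linarith
  qed
  finally have "accel_potential \<mu> \<Phi> xs x' z' \<le> (1 - \<tau> / 2) * E + 4 / \<tau> * \<delta>"
    using \<tau> by simp
  then show ?thesis by (simp add: z'_def E_def \<delta>_def y_def)
qed

end

section \<open>Accelerated loops\<close>

text \<open>
  The argument \<open>S y w\<close> is the solver for the proximal subproblem at \<open>y\<close>, started at \<open>w\<close>.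
\<close>

primrec accel_alg ::
    "real \<Rightarrow> (fseq \<Rightarrow> fseq \<Rightarrow> algorithm) \<Rightarrow> nat \<Rightarrow> fseq \<Rightarrow> fseq \<Rightarrow> algorithm" where
  "accel_alg \<tau> S 0 x z = Output x"
| "accel_alg \<tau> S (Suc N) x z =
    alg_bind (S (accel_point \<tau> x z) x) (\<lambda>x'. accel_alg \<tau> S N x' (x + (1 / \<tau>) *\<^sub>R (x' - x)))"

text \<open>
  By \<open>accel_warm_start\<close> a solver with factor \<open>\<tau>\<^sup>2 / 32\<close> leaves an expected error of at most
  \<open>\<tau>\<^sup>2 / 16\<close> times the potential. By \<open>accel_step\<close> this costs \<open>\<tau> / 4\<close>, half of the
  contraction \<open>\<tau> / 2\<close> of an exact step. The factor \<open>3 / 2\<close> bounds the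
  ratio of potential to gap at the start, by quadratic growth.
\<close>

lemma accel_alg_contracts:
  assumes \<phi>: "tangent_bounds (Rn n) L \<phi> G"
    and \<Phi>: "\<And>x. \<Phi> x = \<phi> x + \<psi> x" and sc: "strongly_convex_on (Rn n) \<mu> \<Phi>"
    and scQ: "\<And>y. y \<in> Rn n \<Longrightarrow> strongly_convex_on (Rn n) L (prox_model L G \<psi> y)"
    and \<mu>: "0 < \<mu>" and \<tau>: "0 < \<tau>" "\<tau> \<le> 1 / 2" "L * \<tau>\<^sup>2 = \<mu> / 2"
    and ex: "\<And>y. y \<in> Rn n \<Longrightarrow>
      \<exists>v\<in>Rn n. \<forall>u\<in>Rn n. prox_model L G \<psi> y v \<le> prox_model L G \<psi> y u"
    and S: "\<And>y. y \<in> Rn n \<Longrightarrow> contracts n m df dg (prox_model L G \<psi> y) (\<tau>\<^sup>2 / 32) a b (S y)"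
  shows "contracts n m df dg \<Phi> (3 / 2 * (1 - \<tau> / 4) ^ N) (N * a) (N * b) (\<lambda>x. accel_alg \<tau> S N x x)"
proof (rule contractsI)
  have y_in: "accel_point \<tau> x z \<in> Rn n" if "x \<in> Rn n" "z \<in> Rn n" for x z
    using that unfolding accel_point_def
    by (intro subspace_add[OF subspace_Rn] subspace_scale[OF subspace_Rn] subspace_diff[OF subspace_Rn])
  have z_in: "x + (1 / \<tau>) *\<^sub>R (x' - x) \<in> Rn n" if "x \<in> Rn n" "x' \<in> Rn n" for x x'
    using that
    by (intro subspace_add[OF subspace_Rn] subspace_scale[OF subspace_Rn] subspace_diff[OF subspace_Rn])
  have run: "bounded_run n m df dg (accel_alg \<tau> S N x z) (N * a) (N * b)"
    if "x \<in> Rn n" "z \<in> Rn n" for N x z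
    using that
  proof (induction N arbitrary: x z)
    case (Suc N)
    show ?case
      using bounded_run_bind[OF contractsD(1)[OF S[OF y_in[OF Suc.prems]] Suc.prems(1)] Suc.IH]
        z_in Suc.prems by simp
  qed simp
  fix w assume w: "w \<in> Rn n"
  show "bounded_run n m df dg (accel_alg \<tau> S N w w) (N * a) (N * b)" by (rule run[OF w w])
  fix xs assume xs: "xs \<in> Rn n" "\<And>u. u \<in> Rn n \<Longrightarrow> \<Phi> xs \<le> \<Phi> u"
  note ctx = subspace_Rn \<phi> \<Phi> sc scQ \<mu> \<tau> xs
  let ?E = "accel_potential \<mu> \<Phi> xs"
  let ?q = "1 - \<tau> / 4"
  have "expect df dg (accel_alg \<tau> S N x z) (\<lambda>u. \<Phi> u - \<Phi> xs) \<le> ?q ^ N * ?E x z"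
    if "x \<in> Rn n" "z \<in> Rn n" for N x z
    using that
  proof (induction N arbitrary: x z)
    case 0
    then show ?case using \<mu> by (simp add: accel_potential_def)
  next
    case (Suc N)
    note x = Suc.prems(1) and z = Suc.prems(2)
    define y where "y = accel_point \<tau> x z"
    have y: "y \<in> Rn n" unfolding y_def by (rule y_in[OF x z])
    let ?Q = "prox_model L G \<psi> y"
    obtain v where v: "v \<in> Rn n" "\<And>u. u \<in> Rn n \<Longrightarrow> ?Q v \<le> ?Q u" using ex[OF y] by blast
    note runS = contractsD(1)[OF S[OF y] x]
    have "expect df dg (S y x) (\<lambda>u. ?Q u - ?Q v) \<le> \<tau>\<^sup>2 / 32 * (?Q x - ?Q v)"
      by (rule contractsD(2)[OF S[OF y] x v])
    also have "\<dots> \<le> \<tau>\<^sup>2 / 32 * (2 * ?E x z)"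
      using accel_warm_start[OF ctx x z v(1)] by (intro mult_left_mono) (auto simp: y_def)
    finally have inexact: "expect df dg (S y x) (\<lambda>u. ?Q u - ?Q v) \<le> \<tau>\<^sup>2 / 16 * ?E x z" by simp
    have "expect df dg (accel_alg \<tau> S (Suc N) x z) (\<lambda>u. \<Phi> u - \<Phi> xs) = expect df dg (S y x)
        (\<lambda>x'. expect df dg (accel_alg \<tau> S N x' (x + (1 / \<tau>) *\<^sub>R (x' - x))) (\<lambda>u. \<Phi> u - \<Phi> xs))"
      by (simp add: expect_bind y_def)
    also have "\<dots> \<le> expect df dg (S y x)
        (\<lambda>x'. ?q ^ N * ((1 - \<tau> / 2) * ?E x z) + (?q ^ N * (4 / \<tau>)) * (?Q x' - ?Q v))"
    proof (rule expect_mono[OF runS])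
      fix x' assume x': "x' \<in> Rn n"
      have "expect df dg (accel_alg \<tau> S N x' (x + (1 / \<tau>) *\<^sub>R (x' - x))) (\<lambda>u. \<Phi> u - \<Phi> xs)
          \<le> ?q ^ N * ?E x' (x + (1 / \<tau>) *\<^sub>R (x' - x))"
        by (rule Suc.IH[OF x' z_in[OF x x']])
      also have "\<dots> \<le> ?q ^ N * ((1 - \<tau> / 2) * ?E x z + 4 / \<tau> * (?Q x' - ?Q v))"
        using accel_step[OF ctx x z x' v(1)] v(2) \<tau> by (intro mult_left_mono) (auto simp: y_def)
      finally show "expect df dg (accel_alg \<tau> S N x' (x + (1 / \<tau>) *\<^sub>R (x' - x))) (\<lambda>u. \<Phi> u - \<Phi> xs)
          \<le> ?q ^ N * ((1 - \<tau> / 2) * ?E x z) + (?q ^ N * (4 / \<tau>)) * (?Q x' - ?Q v)"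
        by (simp only: distrib_left mult.assoc)
    qed
    also have "\<dots> = ?q ^ N * ((1 - \<tau> / 2) * ?E x z)
        + (?q ^ N * (4 / \<tau>)) * expect df dg (S y x) (\<lambda>x'. ?Q x' - ?Q v)"
      by (rule expect_affine[OF runS])
    also have "\<dots> \<le> ?q ^ N * ((1 - \<tau> / 2) * ?E x z) + (?q ^ N * (4 / \<tau>)) * (\<tau>\<^sup>2 / 16 * ?E x z)"
      using \<tau> by (intro add_left_mono mult_left_mono[OF inexact]) auto
    also have "\<dots> = ?q ^ Suc N * ?E x z"
      using \<tau> by (simp add: field_simps power2_eq_square)
    finally show ?case .
  qed
  from this[OF w w] have "expect df dg (accel_alg \<tau> S N w w) (\<lambda>u. \<Phi> u - \<Phi> xs) \<le> ?q ^ N * ?E w w" .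
  also have "\<dots> \<le> ?q ^ N * (3 / 2 * (\<Phi> w - \<Phi> xs))"
    using strongly_convex_on_growth[OF sc xs w] \<tau>
    by (intro mult_left_mono) (auto simp: accel_potential_def)
  finally show "expect df dg (accel_alg \<tau> S N w w) (\<lambda>u. \<Phi> u - \<Phi> xs)
      \<le> 3 / 2 * ?q ^ N * (\<Phi> w - \<Phi> xs)"
    by (simp only: mult_ac)
qed

definition svrg_prox :: "nat \<Rightarrow> real \<Rightarrow> real \<Rightarrow> real \<Rightarrow> nat \<Rightarrow> nat \<Rightarrow> fseq \<Rightarrow> fseq \<Rightarrow> fseq \<Rightarrow> algorithm" where
  "svrg_prox m Lg s \<kappa> T j c y =
    alg_iter (svrg_epoch m (1 / (10 * (Lg + (s + \<kappa>)))) (c - \<kappa> *\<^sub>R y) (s + \<kappa>) T) j"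

text \<open>
  A proximal step on a regularized average is again a problem about a regularized average, so one
  stochastic solver serves every subproblem.
\<close>

lemma prox_model_reg_avg:
  assumes "\<And>x. \<psi> x = reg_avg m g c s x"
  shows "prox_model \<kappa> G \<psi> y x = reg_avg m g (c + G y - \<kappa> *\<^sub>R y) (s + \<kappa>) x + \<kappa> / 2 * (norm y)\<^sup>2"
  by (simp add: prox_model_def assms reg_avg_def power2_norm_eq_inner inner_diff_left inner_diff_right
      inner_add_left inner_commute algebra_simps add_divide_distrib)

lemma reg_avg_ex_minimizer:
  assumes g: "\<And>k. k \<in> {1..m} \<Longrightarrow> tangent_bounds (Rn n) Lg (g k) (dg k)"
    and cvx: "\<And>k. k \<in> {1..m} \<Longrightarrow> convex_on (Rn n) (g k)"
    and "0 < Lg" "0 < s" "1 \<le> m" "c \<in> Rn n"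
  shows "\<exists>v\<in>Rn n. \<forall>u\<in>Rn n. reg_avg m g c s v \<le> reg_avg m g c s u"
proof -
  have "tangent_bounds (Rn n) (Lg + s) (reg_avg m g c s)
      (\<lambda>x. (1 / real m) *\<^sub>R (\<Sum>k=1..m. dg k x) + (c + s *\<^sub>R x))"
    using assms(3-6) by (intro reg_avg_tangent_bounds g) auto
  from ex_minimizer[OF subspace_Rn complete_Rn this reg_avg_strongly_convex[OF cvx]] assms(3,4)
  show ?thesis by (metis add_pos_pos)
qed

text \<open>
  This is the accelerated proximal point method: the acceleration lemma with \<open>\<phi> = 0\<close>, which is
  smooth with every constant \<open>\<kappa>\<close>. The added curvature \<open>\<kappa>\<close> makes the subproblems so well
  conditioned that a short epoch halves their gap.
\<close>

lemma prox_contracts: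
  assumes g: "\<And>k. k \<in> {1..m} \<Longrightarrow> tangent_bounds (Rn n) Lg (g k) (dg k)"
    and cvx: "\<And>k. k \<in> {1..m} \<Longrightarrow> convex_on (Rn n) (g k)"
    and pos: "0 < Lg" "0 < s" "0 < \<kappa>" and m: "1 \<le> m" and c: "c \<in> Rn n"
    and T: "50 * (Lg + (s + \<kappa>)) \<le> (s + \<kappa>) * real T"
    and \<tau>: "0 < \<tau>" "\<tau> \<le> 1 / 2" "\<kappa> * \<tau>\<^sup>2 = s / 2" and j: "(1 / 2) ^ j \<le> \<tau>\<^sup>2 / 32"
  shows "contracts n m df dg (reg_avg m g c s) (3 / 2 * (1 - \<tau> / 4) ^ N) 0 (N * (j * (m + 2 * T)))
    (\<lambda>x. accel_alg \<tau> (svrg_prox m Lg s \<kappa> T j c) N x x)"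
proof -
  let ?Q = "prox_model \<kappa> (\<lambda>_. 0) (reg_avg m g c s)"
  have Q: "?Q y x = reg_avg m g (c - \<kappa> *\<^sub>R y) (s + \<kappa>) x + \<kappa> / 2 * (norm y)\<^sup>2" for x y
    using prox_model_reg_avg[of "reg_avg m g c s" m g c s \<kappa> "\<lambda>_. 0" y x] by simp
  have cy: "c - \<kappa> *\<^sub>R y \<in> Rn n" if "y \<in> Rn n" for y
    using c that by (intro subspace_diff[OF subspace_Rn] subspace_scale[OF subspace_Rn])
  have "contracts n m df dg (reg_avg m g c s) (3 / 2 * (1 - \<tau> / 4) ^ N) (N * 0) (N * (j * (m + 2 * T)))
      (\<lambda>x. accel_alg \<tau> (svrg_prox m Lg s \<kappa> T j c) N x x)"
  proof (rule accel_alg_contracts[where \<phi> = "\<lambda>_. 0" and G = "\<lambda>_. 0" and L = \<kappa>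
        and \<psi> = "reg_avg m g c s" and \<mu> = s])
    show "tangent_bounds (Rn n) \<kappa> (\<lambda>_. 0) (\<lambda>_. 0)"
      using pos subspace_0[OF subspace_Rn] by (simp add: tangent_bounds_def)
    show "strongly_convex_on (Rn n) s (reg_avg m g c s)" by (rule reg_avg_strongly_convex[OF cvx])
    fix y assume y: "y \<in> Rn n"
    have "strongly_convex_on (Rn n) (s + \<kappa>) (?Q y)"
      unfolding Q[abs_def] by (intro strongly_convex_on_add_const reg_avg_strongly_convex cvx)
    then show "strongly_convex_on (Rn n) \<kappa> (?Q y)"
      by (rule strongly_convex_on_mono) (use pos in simp)
    show "\<exists>v\<in>Rn n. \<forall>u\<in>Rn n. ?Q y v \<le> ?Q y u"
      using reg_avg_ex_minimizer[where s = "s + \<kappa>", OF g cvx pos(1) _ m cy[OF y]] pos by (simp add: Q)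
    have "contracts n m df dg (reg_avg m g (c - \<kappa> *\<^sub>R y) (s + \<kappa>)) ((1 / 2) ^ j) (j * 0) (j * (m + 2 * T))
        (svrg_prox m Lg s \<kappa> T j c y)"
      unfolding svrg_prox_def using pos
      by (intro contracts_iter svrg_epoch_contracts g cvx m cy y T) auto
    from contracts_weaken[OF contracts_shift[OF this Q] j]
    show "contracts n m df dg (?Q y) (\<tau>\<^sup>2 / 32) 0 (j * (m + 2 * T)) (svrg_prox m Lg s \<kappa> T j c y)"
      by simp
  qed (use pos \<tau> in auto)
  then show ?thesis by simp
qed

text \<open>
  One evaluation of the gradient of \<open>f\<close> is used for a whole inner minimization in which only the
  gradients of the summands are evaluated.
\<close>

definition sliding_step ::
    "nat \<Rightarrow> real \<Rightarrow> real \<Rightarrow> real \<Rightarrow> real \<Rightarrow> nat \<Rightarrow> nat \<Rightarrow> nat \<Rightarrow> fseq \<Rightarrow> fseq \<Rightarrow> algorithm" where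
  "sliding_step m Lf Lg \<kappa> \<tau> T j N y w = Grad_f y (\<lambda>d.
     accel_alg \<tau> (svrg_prox m Lg Lf \<kappa> T j (d - Lf *\<^sub>R y)) N w w)"

lemma sliding_contracts:
  assumes f: "tangent_bounds (Rn n) Lf f df"
    and g: "\<And>k. k \<in> {1..m} \<Longrightarrow> tangent_bounds (Rn n) Lg (g k) (dg k)"
    and cvx: "\<And>k. k \<in> {1..m} \<Longrightarrow> convex_on (Rn n) (g k)"
    and sc: "strongly_convex_on (Rn n) \<mu> (objective m f g)"
    and pos: "0 < Lg" "0 < Lf" "0 < \<kappa>" "0 < \<mu>" and m: "1 \<le> m"
    and T: "50 * (Lg + (Lf + \<kappa>)) \<le> (Lf + \<kappa>) * real T"
    and \<tau>': "0 < \<tau>'" "\<tau>' \<le> 1 / 2" "\<kappa> * \<tau>'\<^sup>2 = Lf / 2" and j: "(1 / 2) ^ j \<le> \<tau>'\<^sup>2 / 32"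
    and \<tau>: "0 < \<tau>" "\<tau> \<le> 1 / 2" "Lf * \<tau>\<^sup>2 = \<mu> / 2"
    and N': "3 / 2 * (1 - \<tau>' / 4) ^ N' \<le> \<tau>\<^sup>2 / 32"
  shows "contracts n m df dg (objective m f g) (3 / 2 * (1 - \<tau> / 4) ^ N)
    N (N * (N' * (j * (m + 2 * T))))
    (\<lambda>x. accel_alg \<tau> (sliding_step m Lf Lg \<kappa> \<tau>' T j N') N x x)"
proof -
  let ?Q = "prox_model Lf df (reg_avg m g 0 0)"
  have Q: "?Q y x = reg_avg m g (df y - Lf *\<^sub>R y) Lf x + Lf / 2 * (norm y)\<^sup>2" for x y
    using prox_model_reg_avg[of "reg_avg m g 0 0" m g 0 0 Lf df y x] by simp
  have cy: "df y - Lf *\<^sub>R y \<in> Rn n" if "y \<in> Rn n" for y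
    using tangent_boundsD(1)[OF f that] that
    by (intro subspace_diff[OF subspace_Rn] subspace_scale[OF subspace_Rn])
  have "contracts n m df dg (objective m f g) (3 / 2 * (1 - \<tau> / 4) ^ N)
    (N * 1) (N * (N' * (j * (m + 2 * T))))
    (\<lambda>x. accel_alg \<tau> (sliding_step m Lf Lg \<kappa> \<tau>' T j N') N x x)"
  proof (rule accel_alg_contracts[OF f _ sc])
    show "objective m f g x = f x + reg_avg m g 0 0 x" for x
      by (simp add: objective_def reg_avg_def)
    fix y assume y: "y \<in> Rn n"
    show "strongly_convex_on (Rn n) Lf (?Q y)"
      unfolding Q[abs_def] by (intro strongly_convex_on_add_const reg_avg_strongly_convex cvx)
    show "\<exists>v\<in>Rn n. \<forall>u\<in>Rn n. ?Q y v \<le> ?Q y u"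
      using reg_avg_ex_minimizer[OF g cvx pos(1,2) m cy[OF y]] by (simp add: Q)
    have "contracts n m df dg (reg_avg m g (df y - Lf *\<^sub>R y) Lf) (3 / 2 * (1 - \<tau>' / 4) ^ N') 0
        (N' * (j * (m + 2 * T)))
        (\<lambda>x. accel_alg \<tau>' (svrg_prox m Lg Lf \<kappa> T j (df y - Lf *\<^sub>R y)) N' x x)"
      by (rule prox_contracts[OF g cvx pos(1-3) m cy[OF y] T \<tau>' j])
    from contracts_weaken[OF contracts_shift[OF this Q] N']
    show "contracts n m df dg (?Q y) (\<tau>\<^sup>2 / 32) 1 (N' * (j * (m + 2 * T)))
        (sliding_step m Lf Lg \<kappa> \<tau>' T j N' y)"
      using y by (simp add: contracts_def sliding_step_def)
  qed (use pos \<tau> in auto)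
  then show ?thesis by simp
qed

section \<open>Iteration counts and the complexity bound\<close>

definition contraction_steps :: "real \<Rightarrow> real \<Rightarrow> nat" where
  "contraction_steps \<tau> A = nat \<lceil>4 / \<tau> * ln A\<rceil>"

lemma contraction_steps_contract:
  assumes "0 < \<tau>" "\<tau> \<le> 4" "1 \<le> A"
  shows "(1 - \<tau> / 4) ^ contraction_steps \<tau> A \<le> 1 / A"
proof -
  define k where "k = contraction_steps \<tau> A"
  have "4 / \<tau> * ln A \<le> real k" unfolding k_def contraction_steps_def by (rule real_nat_ceiling_ge)
  then have k: "ln A \<le> real k * (\<tau> / 4)" using assms by (simp add: field_simps)
  have "(1 - \<tau> / 4) ^ k \<le> exp (- (\<tau> / 4)) ^ k"
    using assms exp_ge_add_one_self[of "- (\<tau> / 4)"] by (intro power_mono) auto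
  also have "\<dots> = exp (- (real k * (\<tau> / 4)))" by (simp add: exp_of_nat_mult[symmetric])
  also have "\<dots> \<le> exp (- ln A)" using k by simp
  also have "\<dots> = 1 / A" using assms by (simp add: exp_minus inverse_eq_divide)
  finally show ?thesis by (simp add: k_def)
qed

text \<open>
  Every reduction factor \<open>A\<close> occurring below is at most a power of the argument \<open>X\<close> of the logarithm in
  \<^const>\<open>log_factor\<close>; the additional one in \<open>Suc q\<close> accounts for rounding up.
\<close>

lemma contraction_steps_le:
  assumes "0 < \<tau>" "\<tau> \<le> 4" "1 \<le> A" "A \<le> X ^ q" "exp 1 \<le> X"
  shows "real (contraction_steps \<tau> A) \<le> 4 / \<tau> * (real (Suc q) * ln X)"
proof -
  have X: "0 < X" using assms(5) by (rule less_le_trans[OF exp_gt_zero])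
  have lnX: "1 \<le> ln X" using assms(5) X by (simp add: ln_ge_iff)
  have "ln A \<le> ln (X ^ q)" using assms X by (subst ln_le_cancel_iff) auto
  then have lnA: "ln A \<le> real q * ln X" using X by (simp add: ln_realpow)
  have "0 \<le> 4 / \<tau> * ln A" using assms by simp
  then have "real (contraction_steps \<tau> A) \<le> 4 / \<tau> * ln A + 1"
    unfolding contraction_steps_def by linarith
  also have "\<dots> \<le> 4 / \<tau> * (real q * ln X) + 4 / \<tau> * ln X"
  proof (intro add_mono mult_left_mono lnA)
    have "1 \<le> 4 / \<tau>" using assms by simp
    from mult_mono[OF this lnX] show "1 \<le> 4 / \<tau> * ln X" using assms by simp
  qed (use assms in simp)
  also have "\<dots> = 4 / \<tau> * (real (Suc q) * ln X)" by (simp add: algebra_simps add_divide_distrib)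
  finally show ?thesis .
qed

text \<open>
  The choice \<open>\<kappa> = 2 Lg / m\<close> makes the condition number of the innermost problem of order \<open>m\<close>, so that
  an epoch of \<open>100 m\<close> steps costs no more than a constant number of full gradients of the average. The
  number of outer steps depends on the unknown initial gap; the squared gradient norm at the starting
  point, divided by \<open>2 \<mu>\<close>, is a computable upper bound for it. The halving of the gap by an epoch is
  the rate \<open>1 - 2 / 4\<close>, whence \<open>contraction_steps 2\<close>.
\<close>

definition sliding_alg :: "nat \<Rightarrow> real \<Rightarrow> real \<Rightarrow> real \<Rightarrow> real \<Rightarrow> fseq \<Rightarrow> algorithm" where
  "sliding_alg m Lf Lg \<mu> \<epsilon> x = (
    let \<kappa> = 2 * Lg / real m;
        \<tau> = sqrt (\<mu> / (2 * Lf));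
        \<tau>' = sqrt (Lf / (2 * \<kappa>));
        j = contraction_steps 2 (32 / \<tau>'\<^sup>2);
        N' = contraction_steps \<tau>' (48 / \<tau>\<^sup>2)
    in Grad_f x (\<lambda>d. sum_grads m x 0 (\<lambda>\<sigma>.
         accel_alg \<tau> (sliding_step m Lf Lg \<kappa> \<tau>' (100 * m) j N')
           (contraction_steps \<tau> (1 + 3 / 2 * ((norm (d + (1 / real m) *\<^sub>R \<sigma>))\<^sup>2 / (2 * \<mu>)) / \<epsilon>)) x x)))"

text \<open>
  The first bound minimizes the quadratic lower bound at \<open>x\<close>, the second takes a gradient step. Together
  they show that the estimate of the gap used by the algorithm is too large by the condition number
  at most, which is harmless inside a logarithm.
\<close>

lemma gap_gradient_bounds:
  assumes V: "subspace V" and h: "tangent_bounds V L h G" and L: "0 < L"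
    and sc: "strongly_convex_on V \<mu> h" and \<mu>: "0 < \<mu>" and x: "x \<in> V"
    and xs: "xs \<in> V" "\<And>u. u \<in> V \<Longrightarrow> h xs \<le> h u"
  shows "h x - h xs \<le> (norm (G x))\<^sup>2 / (2 * \<mu>)" and "(norm (G x))\<^sup>2 \<le> 2 * L * (h x - h xs)"
proof -
  define d where "d = xs - x"
  have "h x + inner (G x) d + \<mu> / 2 * (norm d)\<^sup>2 \<le> h xs"
    unfolding d_def by (rule strongly_convex_on_lower[OF sc x xs(1)]) (rule tangent_boundsD(2)[OF h x])
  moreover have "0 \<le> (norm (G x + \<mu> *\<^sub>R d))\<^sup>2 / (2 * \<mu>)" using \<mu> by simp
  moreover have "(norm (G x + \<mu> *\<^sub>R d))\<^sup>2 / (2 * \<mu>)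
      = (norm (G x))\<^sup>2 / (2 * \<mu>) + inner (G x) d + \<mu> / 2 * (norm d)\<^sup>2"
    using \<mu> unfolding norm_sq_add_scaled by (simp add: field_simps power2_eq_square)
  ultimately show "h x - h xs \<le> (norm (G x))\<^sup>2 / (2 * \<mu>)" by linarith
  define z where "z = x + (- (1 / L)) *\<^sub>R G x"
  have z: "z \<in> V"
    unfolding z_def by (intro subspace_add[OF V] subspace_scale[OF V] x tangent_boundsD(1)[OF h x])
  have "h xs \<le> h x + inner (G x) (z - x) + L / 2 * (norm (z - x))\<^sup>2"
    using xs(2)[OF z] tangent_boundsD(3)[OF h x z] by linarith
  also have "\<dots> = h x - (norm (G x))\<^sup>2 / (2 * L)"
    using L by (simp add: z_def power_divide flip: power2_norm_eq_inner)
      (simp add: field_simps power2_eq_square)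
  finally show "(norm (G x))\<^sup>2 \<le> 2 * L * (h x - h xs)" using L by (simp add: field_simps)
qed

text \<open>
  The oracle counts are products of the step numbers of the nested loops. Apart from logarithms, there are
  \<open>1 / \<tau> = sqrt (2 Lf / \<mu>)\<close> outer steps with one gradient of \<open>f\<close> each, and
  \<open>1 / \<tau>' = sqrt (4 Lg / (m Lf))\<close> proximal point steps inside each of them, every one costing
  a multiple of \<open>m\<close> summand gradients; in the product \<open>m / (\<tau> \<tau>') = sqrt (8 m Lg / \<mu>)\<close> the
  constant \<open>Lf\<close> cancels. The assumption \<open>m Lf \<le> Lg\<close> gives \<open>\<tau>' \<le> 1 / 2\<close>, and \<open>m \<le> Lg / \<mu>\<close>
  absorbs the initial full gradient.
\<close>

lemma sliding_alg_correct:
  fixes m :: nat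
  assumes P: "composite_problem n m Lf Lg \<mu> f g"
    and cond: "2 \<le> Lf / \<mu>" "real m \<le> Lg / \<mu>" "real m * Lf \<le> Lg"
    and x: "x \<in> Rn n" and \<epsilon>: "0 < \<epsilon>"
  defines "F \<equiv> objective m f g"
  defines "X \<equiv> exp 1 + Lf / \<mu> + Lg / \<mu> + real m + (F x - min_value n F) / \<epsilon>"
  obtains a b where
    "bounded_run n m (grad n f) (\<lambda>k. grad n (g k)) (sliding_alg m Lf Lg \<mu> \<epsilon> x) a b"
    "expect (grad n f) (\<lambda>k. grad n (g k)) (sliding_alg m Lf Lg \<mu> \<epsilon> x) F - min_value n F \<le> \<epsilon>"
    "1 \<le> ln X"
    "real a \<le> 10 ^ 7 * sqrt (Lf / \<mu>) * ln X ^ 3"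
    "real b \<le> 10 ^ 7 * sqrt (real m * Lg / \<mu>) * ln X ^ 3"
proof -
  let ?df = "grad n f" and ?dg = "\<lambda>k. grad n (g k)"
  have m: "1 \<le> m" and \<mu>: "0 < \<mu>" and f: "tangent_bounds (Rn n) Lf f ?df"
    and g: "\<And>k. k \<in> {1..m} \<Longrightarrow> tangent_bounds (Rn n) Lg (g k) (?dg k)"
    and cvx: "\<And>k. k \<in> {1..m} \<Longrightarrow> convex_on (Rn n) (g k)"
    and sc: "strongly_convex_on (Rn n) \<mu> F"
    using P by (auto simp: composite_problem_def F_def convex_smooth_tangent_bounds)
      (auto simp: convex_smooth_def)
  have m0: "0 < real m" using m by simp
  have Lf\<mu>: "2 * \<mu> \<le> Lf" using cond(1) \<mu> by (simp add: field_simps)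
  have Lf: "0 < Lf" using Lf\<mu> \<mu> by linarith
  have Lg: "0 < Lg" using cond(3) m0 Lf by (metis less_le_trans mult_pos_pos)
  define G where "G y = ?df y + (1 / real m) *\<^sub>R (\<Sum>k=1..m. ?dg k y)" for y
  have F: "tangent_bounds (Rn n) (Lf + Lg) F G"
    unfolding F_def G_def objective_def
    by (intro tangent_bounds_add tangent_bounds_average subspace_Rn f g m)
  obtain xs where xs: "xs \<in> Rn n" "\<And>u. u \<in> Rn n \<Longrightarrow> F xs \<le> F u"
    using ex_minimizer[OF subspace_Rn complete_Rn F sc \<mu>] Lf Lg by (metis add_pos_pos)
  have min: "min_value n F = F xs"
    unfolding min_value_def using xs by (intro cInf_eq_minimum) auto
  define r where "r = (F x - F xs) / \<epsilon>"
  define D where "D = (norm (G x))\<^sup>2 / (2 * \<mu>)"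
  note gap = gap_gradient_bounds[OF subspace_Rn F add_pos_pos[OF Lf Lg] sc \<mu> x xs]
  have r0: "0 \<le> r" using xs(2)[OF x] \<epsilon> by (simp add: r_def)
  have X: "X = exp 1 + Lf / \<mu> + Lg / \<mu> + real m + r" by (simp add: X_def r_def min)
  have nn: "0 \<le> Lf / \<mu>" "0 \<le> Lg / \<mu>" using Lf Lg \<mu> by auto
  have Xe: "exp 1 \<le> X" using nn r0 by (simp add: X)
  have X2: "2 \<le> X" using Xe exp_ge_add_one_self[of "1::real"] by linarith
  have XL: "Lf / \<mu> + Lg / \<mu> \<le> X" and Xr: "r \<le> X"
    using nn r0 by (simp_all add: X add_nonneg_nonneg less_imp_le)
  have lnX: "1 \<le> ln X" using Xe X2 by (simp add: ln_ge_iff)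

  define \<kappa> where "\<kappa> = 2 * Lg / real m"
  define \<tau> where "\<tau> = sqrt (\<mu> / (2 * Lf))"
  define \<tau>' where "\<tau>' = sqrt (Lf / (2 * \<kappa>))"
  define j where "j = contraction_steps 2 (32 / \<tau>'\<^sup>2)"
  define N' where "N' = contraction_steps \<tau>' (48 / \<tau>\<^sup>2)"
  define N where "N = contraction_steps \<tau> (1 + 3 / 2 * D / \<epsilon>)"
  have \<kappa>: "0 < \<kappa>" "2 * Lf \<le> \<kappa>" using Lg cond(3) m0 by (auto simp: \<kappa>_def field_simps)
  have \<tau>sq: "\<tau>\<^sup>2 = \<mu> / (2 * Lf)" and \<tau>'sq: "\<tau>'\<^sup>2 = Lf / (2 * \<kappa>)"
    using Lf \<mu> \<kappa> by (auto simp: \<tau>_def \<tau>'_def)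
  have \<tau>0: "0 < \<tau>" "0 < \<tau>'" using Lf \<mu> \<kappa> by (auto simp: \<tau>_def \<tau>'_def)
  have half: "t \<le> 1 / 2" if "t\<^sup>2 \<le> 1 / 4" for t :: real
    by (rule power2_le_imp_le) (use that in \<open>simp_all add: power2_eq_square\<close>)
  have \<tau>: "0 < \<tau>" "\<tau> \<le> 1 / 2" "Lf * \<tau>\<^sup>2 = \<mu> / 2"
    using \<tau>0 half[of \<tau>] Lf\<mu> Lf by (auto simp: \<tau>sq field_simps)
  have \<tau>': "0 < \<tau>'" "\<tau>' \<le> 1 / 2" "\<kappa> * \<tau>'\<^sup>2 = Lf / 2"
    using \<tau>0 half[of \<tau>'] \<kappa> by (auto simp: \<tau>'sq field_simps)
  have A1: "1 \<le> 32 / \<tau>'\<^sup>2" and A2: "1 \<le> 48 / \<tau>\<^sup>2"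
  proof -
    have "t\<^sup>2 \<le> 1" if "0 < t" "t \<le> 1 / 2" for t :: real using that by (intro power_le_one) auto
    from this[OF \<tau>(1,2)] this[OF \<tau>'(1,2)] \<tau>0
    show "1 \<le> 32 / \<tau>'\<^sup>2" "1 \<le> 48 / \<tau>\<^sup>2" by (auto simp: pos_le_divide_eq)
  qed
  have A3: "1 \<le> 1 + 3 / 2 * D / \<epsilon>" using \<mu> \<epsilon> by (simp add: D_def)
  have cj: "(1 / 2) ^ j \<le> \<tau>'\<^sup>2 / 32"
    using contraction_steps_contract[OF _ _ A1, of 2] by (simp add: j_def)
  have cN': "3 / 2 * (1 - \<tau>' / 4) ^ N' \<le> \<tau>\<^sup>2 / 32"
    using contraction_steps_contract[OF _ _ A2, of \<tau>'] \<tau>' by (simp add: N'_def)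
  have T: "50 * (Lg + (Lf + \<kappa>)) \<le> (Lf + \<kappa>) * real (100 * m)"
  proof -
    have "Lf * 1 \<le> Lf * real m" using m Lf by (intro mult_left_mono) auto
    then have "Lf \<le> Lg" using cond(3) by (simp add: mult.commute)
    moreover have "\<kappa> \<le> 2 * Lg" using m0 m Lg by (simp add: \<kappa>_def pos_divide_le_eq)
    moreover have "\<kappa> * real (100 * m) = 200 * Lg" using m0 by (simp add: \<kappa>_def)
    moreover have "0 \<le> Lf * real (100 * m)" using Lf by simp
    ultimately show ?thesis by (simp only: distrib_right distrib_left)
  qed
  note outer = sliding_contracts[OF f g cvx sc[unfolded F_def] Lg Lf \<kappa>(1) \<mu> m T \<tau>' cj \<tau> cN',
      of N, folded F_def]
  let ?outer = "accel_alg \<tau> (sliding_step m Lf Lg \<kappa> \<tau>' (100 * m) j N') N x x"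
  have alg: "sliding_alg m Lf Lg \<mu> \<epsilon> x = Grad_f x (\<lambda>d. sum_grads m x 0 (\<lambda>\<sigma>.
         accel_alg \<tau> (sliding_step m Lf Lg \<kappa> \<tau>' (100 * m) j N')
           (contraction_steps \<tau> (1 + 3 / 2 * ((norm (d + (1 / real m) *\<^sub>R \<sigma>))\<^sup>2 / (2 * \<mu>)) / \<epsilon>)) x x))"
    by (simp add: sliding_alg_def Let_def \<kappa>_def \<tau>_def \<tau>'_def j_def N'_def)
  define b where "b = N * (N' * (j * (m + 2 * (100 * m))))"
  have "bounded_run n m ?df ?dg ?outer N b" unfolding b_def by (rule contractsD(1)[OF outer x])
  then have run: "bounded_run n m ?df ?dg (sliding_alg m Lf Lg \<mu> \<epsilon> x) (Suc N) (m + b)"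
    unfolding alg using x
    by (auto simp: N_def D_def G_def intro!: bounded_run_sum_grads)
  have acc: "expect ?df ?dg (sliding_alg m Lf Lg \<mu> \<epsilon> x) F - min_value n F \<le> \<epsilon>"
  proof -
    have "expect ?df ?dg (sliding_alg m Lf Lg \<mu> \<epsilon> x) F = expect ?df ?dg ?outer F"
      by (simp add: alg expect_sum_grads N_def D_def G_def)
    moreover have "expect ?df ?dg ?outer F - F xs = expect ?df ?dg ?outer (\<lambda>u. F u - F xs)"
      using expect_affine[OF contractsD(1)[OF outer x], of "- F xs" 1 F] by simp
    moreover have "\<dots> \<le> 3 / 2 * (1 - \<tau> / 4) ^ N * (F x - F xs)"
      by (rule contractsD(2)[OF outer x xs])
    moreover have "\<dots> \<le> 3 / 2 * (1 / (1 + 3 / 2 * D / \<epsilon>)) * D"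
    proof (rule mult_mono)
      show "3 / 2 * (1 - \<tau> / 4) ^ N \<le> 3 / 2 * (1 / (1 + 3 / 2 * D / \<epsilon>))"
        unfolding N_def using \<tau> by (intro mult_left_mono contraction_steps_contract A3) auto
      show "F x - F xs \<le> D" using gap(1) by (simp add: D_def)
      show "0 \<le> 3 / 2 * (1 / (1 + 3 / 2 * D / \<epsilon>))" using A3 by simp
    qed (use xs(2)[OF x] in simp)
    moreover have "\<dots> \<le> \<epsilon>"
    proof -
      have "3 / 2 * D \<le> \<epsilon> * (1 + 3 / 2 * D / \<epsilon>)" using \<epsilon> by (simp add: field_simps)
      then have "3 / 2 * D / (1 + 3 / 2 * D / \<epsilon>) \<le> \<epsilon>"
        by (subst pos_divide_le_eq) (use A3 in linarith)+
      then show ?thesis by simp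
    qed
    ultimately show ?thesis by (simp add: min)
  qed
  have jb: "real j \<le> 18 * ln X"
  proof -
    have "128 \<le> (2::real) ^ 7" by simp
    also have "\<dots> \<le> X ^ 7" using X2 by (intro power_mono) auto
    finally have X7: "128 \<le> X ^ 7" .
    have "32 / \<tau>'\<^sup>2 = 128 * (Lg / (real m * Lf))"
      using Lf Lg m0 by (simp add: \<tau>'sq \<kappa>_def)
    also have "Lg / (real m * Lf) \<le> Lg / \<mu>"
    proof (rule divide_left_mono)
      have "1 * \<mu> \<le> real m * Lf" using m Lf\<mu> \<mu> by (intro mult_mono) auto
      then show "\<mu> \<le> real m * Lf" by simp
    qed (use Lg m0 Lf \<mu> in auto)
    also have "128 * (Lg / \<mu>) \<le> X ^ 7 * X" using X7 XL nn by (intro mult_mono) auto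
    finally have "32 / \<tau>'\<^sup>2 \<le> X ^ 8" by (simp add: power_Suc[symmetric] mult.commute del: power_Suc)
    from contraction_steps_le[OF _ _ A1 this Xe, of 2] show ?thesis by (simp add: j_def)
  qed
  have N'b: "real N' \<le> 36 / \<tau>' * ln X"
  proof -
    have "96 \<le> (2::real) ^ 7" by simp
    also have "\<dots> \<le> X ^ 7" using X2 by (intro power_mono) auto
    finally have X7: "96 \<le> X ^ 7" .
    have "48 / \<tau>\<^sup>2 = 96 * (Lf / \<mu>)" using Lf \<mu> by (simp add: \<tau>sq)
    also have "\<dots> \<le> X ^ 7 * X" using X7 XL nn by (intro mult_mono) auto
    finally have "48 / \<tau>\<^sup>2 \<le> X ^ 8" by (simp add: power_Suc[symmetric] mult.commute del: power_Suc)
    from contraction_steps_le[OF _ _ A2 this Xe, of \<tau>'] \<tau>' show ?thesis by (simp add: N'_def)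
  qed
  have Nb: "real N \<le> 16 / \<tau> * ln X"
  proof -
    have "D \<le> (2 * (Lf + Lg) * (F x - F xs)) / (2 * \<mu>)"
      unfolding D_def using gap(2) \<mu> by (intro divide_right_mono) auto
    then have "D / \<epsilon> \<le> (2 * (Lf + Lg) * (F x - F xs)) / (2 * \<mu>) / \<epsilon>"
      using \<epsilon> by (intro divide_right_mono) auto
    also have "\<dots> = (Lf / \<mu> + Lg / \<mu>) * r" using \<mu> \<epsilon> by (simp add: r_def field_simps)
    also have "\<dots> \<le> X * X" using XL Xr nn r0 by (intro mult_mono) auto
    finally have "1 + 3 / 2 * D / \<epsilon> \<le> 1 + 3 / 2 * (X * X)" by simp
    also have "\<dots> \<le> X ^ 3"
    proof -
      have "2 * 2 \<le> X * X" using X2 by (intro mult_mono) auto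
      moreover have "2 * (X * X) \<le> X * (X * X)" using X2 by (intro mult_right_mono) auto
      ultimately show ?thesis by (simp add: power3_eq_cube mult.assoc)
    qed
    finally have "1 + 3 / 2 * D / \<epsilon> \<le> X ^ 3" .
    from contraction_steps_le[OF _ _ A3 this Xe, of \<tau>] \<tau> show ?thesis by (simp add: N_def)
  qed
  have inv\<tau>: "1 / \<tau> = sqrt 2 * sqrt (Lf / \<mu>)"
    using Lf \<mu> by (simp add: \<tau>_def real_sqrt_divide real_sqrt_mult)
  have s1: "1 \<le> sqrt (Lf / \<mu>)" using cond(1) by simp
  have l3: "ln X \<le> ln X ^ 3" using lnX by (intro self_le_power) auto
  have a_bound: "real (Suc N) \<le> 10 ^ 7 * sqrt (Lf / \<mu>) * ln X ^ 3"
  proof -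
    have "sqrt 2 \<le> 2" by (rule real_le_lsqrt) auto
    have "real (Suc N) \<le> 1 + 16 * (1 / \<tau>) * ln X" using Nb by simp
    also have "\<dots> \<le> sqrt (Lf / \<mu>) * ln X + 16 * (2 * sqrt (Lf / \<mu>)) * ln X"
    proof (intro add_mono mult_right_mono mult_left_mono)
      show "1 \<le> sqrt (Lf / \<mu>) * ln X" using mult_mono[OF s1 lnX] s1 by simp
      show "1 / \<tau> \<le> 2 * sqrt (Lf / \<mu>)"
        unfolding inv\<tau> using \<open>sqrt 2 \<le> 2\<close> s1 by (intro mult_right_mono) auto
    qed (use lnX in auto)
    also have "\<dots> = 33 * (sqrt (Lf / \<mu>) * ln X)" by simp
    also have "\<dots> \<le> 10 ^ 7 * (sqrt (Lf / \<mu>) * ln X ^ 3)"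
      using s1 lnX l3 by (intro mult_mono) auto
    finally show ?thesis by simp
  qed
  define S where "S = sqrt (real m * Lg / \<mu>)"
  have mS: "real m \<le> S"
    unfolding S_def
  proof (rule real_le_rsqrt)
    have "real m * real m \<le> real m * (Lg / \<mu>)" using cond(2) by (intro mult_left_mono) auto
    then show "(real m)\<^sup>2 \<le> real m * Lg / \<mu>" by (simp add: power2_eq_square)
  qed
  have S\<tau>: "1 / \<tau> * (1 / \<tau>') * real m \<le> 3 * S"
  proof (rule power2_le_imp_le)
    have "(1 / \<tau> * (1 / \<tau>') * real m)\<^sup>2 = 8 * S\<^sup>2"
      unfolding power_mult_distrib power_divide \<tau>sq \<tau>'sq
      using Lf Lg \<mu> m0 by (simp add: S_def \<kappa>_def power2_eq_square field_simps)
    then show "(1 / \<tau> * (1 / \<tau>') * real m)\<^sup>2 \<le> (3 * S)\<^sup>2" by (simp add: power_mult_distrib)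
  qed (use mS in auto)
  have b_bound: "real (m + b) \<le> 10 ^ 7 * S * ln X ^ 3"
  proof -
    have S0: "0 \<le> S" using mS by linarith
    have "real b = real N * (real N' * (real j * (201 * real m)))" by (simp add: b_def)
    also have "\<dots> \<le> (16 / \<tau> * ln X) * ((36 / \<tau>' * ln X) * ((18 * ln X) * (201 * real m)))"
      using Nb N'b jb lnX \<tau> \<tau>' by (intro mult_mono) auto
    also have "\<dots> = 2083968 * ln X ^ 3 * (1 / \<tau> * (1 / \<tau>') * real m)"
      by (simp add: power3_eq_cube)
    also have "\<dots> \<le> 2083968 * ln X ^ 3 * (3 * S)" using S\<tau> lnX by (intro mult_left_mono) auto
    finally have "real b \<le> 6251904 * (S * ln X ^ 3)" by (simp add: mult_ac)
    moreover have "real m \<le> S * ln X ^ 3"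
      using mult_mono[OF mS, of 1 "ln X ^ 3"] S0 lnX l3 by simp
    moreover have "0 \<le> S * ln X ^ 3" using S0 lnX by simp
    ultimately show ?thesis by simp
  qed
  show ?thesis by (rule that[OF run acc lnX a_bound b_bound[unfolded S_def]])
qed

text \<open>
  The exponent \<open>3\<close> is the number of nested loops, each of which contributes one logarithm.
\<close>

theorem mainTheorem1:
  shows "\<exists>(c\<^sub>0::real) (C::real) (p::nat)
      (A :: nat \<Rightarrow> nat \<Rightarrow> real \<Rightarrow> real \<Rightarrow> real \<Rightarrow> real \<Rightarrow> fseq \<Rightarrow> algorithm).
    1 \<le> c\<^sub>0 \<and> 0 < C \<and>
    (\<forall>n m L\<^sub>f L\<^sub>g \<mu> f g x\<^sub>0 \<epsilon>.
      composite_problem n m L\<^sub>f L\<^sub>g \<mu> f g \<longrightarrow>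
      c\<^sub>0 \<le> L\<^sub>f / \<mu> \<longrightarrow> real m \<le> L\<^sub>g / \<mu> \<longrightarrow> real m * L\<^sub>f \<le> L\<^sub>g \<longrightarrow>
      x\<^sub>0 \<in> Rn n \<longrightarrow> 0 < \<epsilon> \<longrightarrow>
      (let F = objective m f g;
           df = grad n f;
           dg = (\<lambda>k. grad n (g k));
           alg = A n m L\<^sub>f L\<^sub>g \<mu> \<epsilon> x\<^sub>0;
           R = run df dg alg;
           polylog = log_factor (L\<^sub>f / \<mu>) (L\<^sub>g / \<mu>) m ((F x\<^sub>0 - min_value n F) / \<epsilon>) ^ p
       in admissible n m df dg alg \<and>
          solves n F \<epsilon> R \<and>
          (\<forall>(x, a, b)\<in>set_pmf R.
             real a \<le> C * sqrt (L\<^sub>f / \<mu>) * polylog \<and>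
             real b \<le> C * sqrt (real m * L\<^sub>g / \<mu>) * polylog)))"
proof (rule exI[of _ 2], rule exI[of _ "10 ^ 7"], rule exI[of _ 3],
    rule exI[of _ "\<lambda>n m Lf Lg \<mu> \<epsilon> x. sliding_alg m Lf Lg \<mu> \<epsilon> x"], intro conjI allI impI)
  fix n m :: nat and Lf Lg \<mu> \<epsilon> :: real and f g x
  assume P: "composite_problem n m Lf Lg \<mu> f g" and cond: "2 \<le> Lf / \<mu>" "real m \<le> Lg / \<mu>"
    "real m * Lf \<le> Lg" and x: "x \<in> Rn n" and \<epsilon>: "0 < \<epsilon>"
  let ?F = "objective m f g"
  let ?R = "run (grad n f) (\<lambda>k. grad n (g k)) (sliding_alg m Lf Lg \<mu> \<epsilon> x)"
  let ?\<Lambda> = "log_factor (Lf / \<mu>) (Lg / \<mu>) m ((?F x - min_value n ?F) / \<epsilon>)"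
  obtain a b where
    run: "bounded_run n m (grad n f) (\<lambda>k. grad n (g k)) (sliding_alg m Lf Lg \<mu> \<epsilon> x) a b"
    and gap: "expect (grad n f) (\<lambda>k. grad n (g k)) (sliding_alg m Lf Lg \<mu> \<epsilon> x) ?F - min_value n ?F \<le> \<epsilon>"
    and a: "real a \<le> 10 ^ 7 * sqrt (Lf / \<mu>) * ?\<Lambda> ^ 3"
    and b: "real b \<le> 10 ^ 7 * sqrt (real m * Lg / \<mu>) * ?\<Lambda> ^ 3"
    unfolding log_factor_def by (rule sliding_alg_correct[OF P cond x \<epsilon>])
  note run = bounded_run_run[OF run]
  have "solves n ?F \<epsilon> ?R"
    unfolding solves_def using run(2,4) gap by (auto intro: integrable_measure_pmf_finite)
  moreover have "\<forall>(x, a, b)\<in>set_pmf ?R. real a \<le> 10 ^ 7 * sqrt (Lf / \<mu>) * ?\<Lambda> ^ 3 \<and>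
      real b \<le> 10 ^ 7 * sqrt (real m * Lg / \<mu>) * ?\<Lambda> ^ 3"
    using run(3) a b by (fastforce intro: order_trans[OF of_nat_mono])
  ultimately show "let F = ?F; df = grad n f; dg = (\<lambda>k. grad n (g k));
           alg = sliding_alg m Lf Lg \<mu> \<epsilon> x; R = run df dg alg;
           polylog = log_factor (Lf / \<mu>) (Lg / \<mu>) m ((F x - min_value n F) / \<epsilon>) ^ 3
       in admissible n m df dg alg \<and> solves n F \<epsilon> R \<and>
          (\<forall>(x, a, b)\<in>set_pmf R. real a \<le> 10 ^ 7 * sqrt (Lf / \<mu>) * polylog \<and>
             real b \<le> 10 ^ 7 * sqrt (real m * Lg / \<mu>) * polylog)"
    using run(1) by (simp only: Let_def)
qed auto

end
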